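(* Let $c>1$ be a constant. For any $\eta$, there exists an (adaptive) adversary that inserts $n$ items, each with a predicted rank whose error is at most $\eta$, such that any deterministic data structure for learned list labeling with capacity $n$ and $m=cn$ slots incurs $\Omega(n\log^2\eta)$ total element movements.
   Context: Learned list labeling: $n$ elements from a totally ordered universe arrive online, each accompanied by a predicted rank $\tilde r_x$, and must be stored in sorted order in an array of $m$ slots (the slot is the element's label; if $x<y$ then label$(x)<$label$(y)$ at all times). The rank $r_x$ of $x$ is the number of inserted elements smaller than $x$ once all elements have arrived, and the error of $x$ is $|\tilde r_x-r_x|$. An element movement occurs each time an element is assigned a new label. A data structure is deterministic if its labels are a deterministic function of the sequence of insertions (with predictions) so far; the adversary chooses each next element and its predicted rank based on the current labels of the stored elements.
   Formalization: The claim is proved for η ≤ n and an infinite universe; for arbitrary η it fails (for η = 2^n the bound n log²η = n³ exceeds the at most n(n+1)/2 possible movements), and it fails over a universe of only n elements. *)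

theory Defs
  imports Complex_Main
begin

text \<open>
  An insertion is an element together with its predicted rank. A labeling maps exactly the
  stored elements to their slots.
\<close>

type_synonym 'a insertion = "'a \<times> nat"
type_synonym 'a labeling = "'a \<rightharpoonup> nat"

text \<open>
  A deterministic data structure computes the current labels from the insertions so far.
  An adaptive adversary sees the history of the game (each past insertion with the labels held
  by all stored elements right after it) and picks the next element and its predicted rank.
\<close>

type_synonym 'a data_structure = "'a insertion list \<Rightarrow> 'a labeling"
type_synonym 'a history = "('a insertion \<times> 'a labeling) list"
type_synonym 'a adversary = "'a history \<Rightarrow> 'a insertion"

definition elements :: "'a insertion list \<Rightarrow> 'a set" where
  "elements \<sigma> = fst ` set \<sigma>"

definition valid_labeling :: "nat \<Rightarrow> 'a::linorder set \<Rightarrow> 'a labeling \<Rightarrow> bool" where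
  "valid_labeling m S L \<longleftrightarrow>
     dom L = S \<and> ran L \<subseteq> {..<m} \<and> (\<forall>x\<in>S. \<forall>y\<in>S. x < y \<longrightarrow> the (L x) < the (L y))"

text \<open>Correctness is required for arbitrary predictions, however inaccurate.\<close>

definition list_labeling_structure :: "nat \<Rightarrow> nat \<Rightarrow> 'a::linorder data_structure \<Rightarrow> bool" where
  "list_labeling_structure n m D \<longleftrightarrow>
     (\<forall>\<sigma>. length \<sigma> \<le> n \<longrightarrow> distinct (map fst \<sigma>) \<longrightarrow> valid_labeling m (elements \<sigma>) (D \<sigma>))"

primrec play :: "'a adversary \<Rightarrow> 'a data_structure \<Rightarrow> nat \<Rightarrow> 'a history" where
  "play A D 0 = []"
| "play A D (Suc t) =
     (let h = play A D t; q = A h in h @ [(q, D (map fst h @ [q]))])"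

definition inserted :: "'a adversary \<Rightarrow> 'a data_structure \<Rightarrow> nat \<Rightarrow> 'a insertion list" where
  "inserted A D n = map fst (play A D n)"

text \<open>The rank and the error refer to the complete insertion sequence.\<close>

definition rank :: "'a::linorder insertion list \<Rightarrow> 'a \<Rightarrow> nat" where
  "rank \<sigma> x = card {y \<in> elements \<sigma>. y < x}"

definition prediction_error :: "'a::linorder insertion list \<Rightarrow> 'a insertion \<Rightarrow> nat" where
  "prediction_error \<sigma> q = nat \<bar>int (snd q) - int (rank \<sigma> (fst q))\<bar>"

text \<open>
  An unstored element has label \<^const>\<open>None\<close>, so the first label that an element receives
  counts as a movement as well.
\<close>

definition moved :: "'a labeling \<Rightarrow> 'a labeling \<Rightarrow> 'a set" where
  "moved L L' = {x \<in> dom L'. L' x \<noteq> L x}"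

definition total_movements :: "'a data_structure \<Rightarrow> 'a insertion list \<Rightarrow> nat" where
  "total_movements D \<sigma> =
     (\<Sum>t<length \<sigma>. card (moved (D (take t \<sigma>)) (D (take (Suc t) \<sigma>))))"

end

theory Submission imports Defs begin

text \<open>
  The elements come in blocks of \<open>2 * g\<close> with \<open>g = \<eta> div 4\<close>. Half of each block is inserted first, in
  increasing order. As every block eventually receives exactly \<open>g\<close> more elements, the first rank of its
  block predicts the rank of an element up to \<open>\<eta>\<close>, in whatever order the adversary fills the blocks.
  It works in a block that occupies \<open>O(g)\<close> slots.

  There the adversary keeps a chain of \<open>d = \<Theta>(log g)\<close> nested segments and inserts into the innermost
  one. A new segment maximizes \<open>(1 + \<alpha>) * ln (items) - ln (slots)\<close>, \<open>\<alpha> = \<Theta>(1 / d)\<close>, among the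
  segments with at most two thirds of the items of the enclosing one. By maximality no part of constant
  proportion is denser by more than a factor \<open>1 + O(1 / d)\<close>, hence none is sparser either, and the next
  segment can be taken from the middle without losing density.

  A segment of \<open>k\<close> items is saturated after \<open>\<kappa> * k\<close> insertions, \<open>\<kappa> = \<Theta>(1 / d)\<close>: it has then become
  denser than the enclosing segment by a factor \<open>1 + \<Omega>(1 / d)\<close>. As densities are at most \<open>1\<close>, at most
  half of the segments are saturated at any time, so each insertion makes progress on \<open>d / 2\<close>
  levels. On the other hand a segment makes at most \<open>\<kappa> * k\<close> progress in its life, and destroying
  it takes \<open>\<Omega>(k)\<close> movements, because the structure may be assumed to relocate contiguous runs
  around the new element only. So every movement accounts for \<open>O(1 / d)\<close> progress, and an insertion
  costs \<open>\<Omega>(d\<^sup>2)\<close> movements on average.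
\<close>

section \<open>Adversaries from game invariants\<close>

lemma infinite_linorder_chain:
  assumes "infinite (UNIV :: 'a::linorder set)"
  obtains e :: "nat \<Rightarrow> 'a::linorder" where "strict_mono_on {..<K} e"
proof -
  obtain F :: "'a set" where F: "finite F" "card F = K"
    using infinite_arbitrarily_large[OF assms] by blast
  have "strict_mono_on {..<K} ((!) (sorted_list_of_set F))"
  proof (rule strict_mono_onI)
    fix r s assume "r \<in> {..<K}" "s \<in> {..<K}" "r < s"
    then show "sorted_list_of_set F ! r < sorted_list_of_set F ! s"
      using F by (intro sorted_wrt_nth_less[OF strict_sorted_list_of_set]) auto
  qed
  then show ?thesis by (rule that)
qed

definition number_labeling :: "nat \<Rightarrow> nat set \<Rightarrow> (nat \<Rightarrow> nat) \<Rightarrow> bool" where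
  "number_labeling m S f \<longleftrightarrow> strict_mono_on S f \<and> f ` S \<subseteq> {..<m}"

lemma total_movements_snoc:
  "total_movements D (\<sigma> @ [q]) = total_movements D \<sigma> + card (moved (D \<sigma>) (D (\<sigma> @ [q])))"
  unfolding total_movements_def by simp

lemma inserted_Suc:
  "inserted A D (Suc t) = inserted A D t @ [A (play A D t)]"
  by (simp add: inserted_def Let_def)

text \<open>The adversary sees only the history, so it recomputes the inserted numbers, their labels
  and the cost from it and picks a number that keeps \<open>P\<close> whatever the answer. Thus a
  single adversary serves all structures. The summand \<open>1\<close> is the first label of the new
  element.\<close>

lemma adversary_from_invariant:
  fixes P :: "nat list \<Rightarrow> (nat \<Rightarrow> nat) \<Rightarrow> nat \<Rightarrow> bool" and pred :: "nat \<Rightarrow> nat"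
    and e :: "nat \<Rightarrow> 'a::linorder"
  assumes e: "strict_mono_on {..<K} e"
    and init: "\<And>lab. P [] lab 0"
    and step: "\<And>us lab y. P us lab y \<Longrightarrow> length us < n \<Longrightarrow>
      \<exists>u<K. u \<notin> set us \<and> (\<forall>lab'. number_labeling m (set (us @ [u])) lab' \<longrightarrow>
         P (us @ [u]) lab' (y + 1 + card {v \<in> set us. lab' v \<noteq> lab v}))"
  shows "\<exists>A :: 'a adversary. \<forall>D. list_labeling_structure n m D \<longrightarrow>
    (\<exists>us lab. length us = n \<and> distinct us \<and> set us \<subseteq> {..<K} \<and>
       inserted A D n = map (\<lambda>u. (e u, pred u)) us \<and>
       P us lab (total_movements D (inserted A D n)))"
proof -
  define good where "good us lab y u \<longleftrightarrow> u < K \<and> u \<notin> set us \<and>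
    (\<forall>lab'. number_labeling m (set (us @ [u])) lab' \<longrightarrow>
         P (us @ [u]) lab' (y + 1 + card {v \<in> set us. lab' v \<noteq> lab v}))" for us lab y u
  define pick where "pick us lab y = (SOME u. good us lab y u)" for us lab y
  have pick: "good us lab y (pick us lab y)" if "P us lab y" "length us < n" for us lab y
  proof -
    have "\<exists>u. good us lab y u"
      unfolding good_def using step[OF that] by blast
    then show ?thesis
      unfolding pick_def by (rule someI_ex)
  qed
  define upd where "upd = (\<lambda>(us, lab, y) (h :: 'a insertion \<times> 'a labeling).
    let lab' = (\<lambda>v. the (snd h (e v)))
    in (us @ [pick us lab y], lab', y + 1 + card {v \<in> set us. lab' v \<noteq> lab v}))"
  define state where "state h = foldl upd ([], \<lambda>_. 0, 0) h" for h
  define A :: "'a adversary" where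
    "A h = (case state h of (us, lab, y) \<Rightarrow> (e (pick us lab y), pred (pick us lab y)))" for h
  have inj: "inj_on e {..<K}"
    using e by (rule strict_mono_on_imp_inj_on)
  show ?thesis
  proof (intro exI[of _ A] allI impI)
    fix D :: "'a data_structure"
    assume D: "list_labeling_structure n m D"
    have "\<exists>us lab y. state (play A D t) = (us, lab, y) \<and> length us = t \<and> distinct us \<and>
        set us \<subseteq> {..<K} \<and> inserted A D t = map (\<lambda>u. (e u, pred u)) us \<and>
        (\<forall>v\<in>set us. D (inserted A D t) (e v) = Some (lab v)) \<and> P us lab y \<and>
        y = total_movements D (inserted A D t)" if "t \<le> n" for t
      using that
    proof (induction t)
      case 0
      show ?case
        by (auto simp: state_def inserted_def total_movements_def init)
    next
      case (Suc t)
      then obtain us lab y where IH: "state (play A D t) = (us, lab, y)" "length us = t"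
        "distinct us" "set us \<subseteq> {..<K}" "inserted A D t = map (\<lambda>u. (e u, pred u)) us"
        "\<forall>v\<in>set us. D (inserted A D t) (e v) = Some (lab v)" "P us lab y"
        "y = total_movements D (inserted A D t)"
        by auto
      define u where "u = pick us lab y"
      define us' where "us' = us @ [u]"
      define \<sigma> where "\<sigma> = inserted A D (Suc t)"
      define lab' where "lab' v = the (D \<sigma> (e v))" for v
      have u: "u < K" "u \<notin> set us" and P': "\<And>lab'. number_labeling m (set us') lab' \<Longrightarrow>
           P us' lab' (y + 1 + card {v \<in> set us. lab' v \<noteq> lab v})"
        using pick[of us lab y] IH Suc.prems unfolding good_def u_def us'_def by auto
      have q: "A (play A D t) = (e u, pred u)"
        by (simp add: A_def IH u_def)
      have \<sigma>: "\<sigma> = map (\<lambda>u. (e u, pred u)) us'"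
        by (simp add: \<sigma>_def inserted_Suc q IH us'_def)
      have us': "length us' = Suc t" "distinct us'" "set us' \<subseteq> {..<K}"
        using IH u by (auto simp: us'_def)
      have "map fst \<sigma> = map e us'"
        by (simp add: \<sigma> o_def)
      moreover have "distinct (map e us')"
        using us' inj_on_subset[OF inj us'(3)] by (simp add: distinct_map)
      moreover have "length \<sigma> \<le> n"
        using us' Suc.prems by (simp add: \<sigma>)
      ultimately have "valid_labeling m (elements \<sigma>) (D \<sigma>)"
        using D unfolding list_labeling_structure_def by simp
      moreover have el: "elements \<sigma> = e ` set us'"
        by (auto simp: elements_def \<sigma> image_image)
      ultimately have val: "dom (D \<sigma>) = e ` set us'" "ran (D \<sigma>) \<subseteq> {..<m}"
        "\<And>v w. v \<in> set us' \<Longrightarrow> w \<in> set us' \<Longrightarrow> e v < e w \<Longrightarrow> lab' v < lab' w"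
        by (auto simp: valid_labeling_def lab'_def)
      have lab': "D \<sigma> (e v) = Some (lab' v)" if "v \<in> set us'" for v
      proof -
        have "e v \<in> dom (D \<sigma>)"
          using that val(1) by blast
        then show ?thesis
          by (auto simp: lab'_def)
      qed
      have "number_labeling m (set us') lab'"
        unfolding number_labeling_def
      proof (intro conjI strict_mono_onI)
        fix r s assume "r \<in> set us'" "s \<in> set us'" "r < s"
        then show "lab' r < lab' s"
          using val(3) strict_mono_onD[OF e] us'(3) by blast
      next
        show "lab' ` set us' \<subseteq> {..<m}"
          using val(2) lab' by (force simp: ran_def)
      qed
      then have P'': "P us' lab' (y + 1 + card {v \<in> set us. lab' v \<noteq> lab v})"
        by (rule P')
      have domold: "D (inserted A D t) (e u) = None"
      proof -
        have "map fst (inserted A D t) = map e us"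
          by (simp add: IH(5) o_def)
        moreover have "distinct (map e us)"
          using IH(3) inj_on_subset[OF inj IH(4)] by (simp add: distinct_map)
        moreover have "length (inserted A D t) \<le> n"
          using IH(2,5) Suc.prems by simp
        ultimately have "valid_labeling m (elements (inserted A D t)) (D (inserted A D t))"
          using D unfolding list_labeling_structure_def by simp
        then have "dom (D (inserted A D t)) = e ` set us"
          by (auto simp: valid_labeling_def elements_def IH(5) image_image)
        moreover have "e u \<notin> e ` set us"
          using inj u IH(4) by (auto simp: inj_on_def)
        ultimately show ?thesis by blast
      qed
      have "moved (D (inserted A D t)) (D \<sigma>) = e ` insert u {v \<in> set us. lab' v \<noteq> lab v}"
        using domold lab' IH(6) unfolding moved_def val(1) us'_def by auto
      moreover have "inj_on e (insert u {v \<in> set us. lab' v \<noteq> lab v})"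
        by (rule inj_on_subset[OF inj]) (use u IH(4) in auto)
      ultimately have mv: "card (moved (D (inserted A D t)) (D \<sigma>)) =
          1 + card {v \<in> set us. lab' v \<noteq> lab v}"
        using u by (simp add: card_image)
      have st: "state (play A D (Suc t)) =
          (us', lab', y + 1 + card {v \<in> set us. lab' v \<noteq> lab v})"
        using IH(1) unfolding lab'_def \<sigma>_def us'_def u_def
        by (simp add: state_def upd_def Let_def inserted_def)
      have tot: "total_movements D \<sigma> = y + 1 + card {v \<in> set us. lab' v \<noteq> lab v}"
        using mv IH(8) unfolding \<sigma>_def inserted_Suc by (simp add: total_movements_snoc)
      have "state (play A D (Suc t)) = (us', lab', total_movements D \<sigma>) \<and> length us' = Suc t \<and>
          distinct us' \<and> set us' \<subseteq> {..<K} \<and> \<sigma> = map (\<lambda>u. (e u, pred u)) us' \<and>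
          (\<forall>v\<in>set us'. D \<sigma> (e v) = Some (lab' v)) \<and> P us' lab' (total_movements D \<sigma>) \<and>
          total_movements D \<sigma> = total_movements D \<sigma>"
        using us' \<sigma> lab' P'' tot st by simp
      then show ?case
        unfolding \<sigma>_def by blast
    qed
    from this[of n] show "\<exists>us lab. length us = n \<and> distinct us \<and> set us \<subseteq> {..<K} \<and>
       inserted A D n = map (\<lambda>u. (e u, pred u)) us \<and>
       P us lab (total_movements D (inserted A D n))"
      by auto
  qed
qed

lemma rank_embedded:
  assumes e: "strict_mono_on {..<K} (e :: nat \<Rightarrow> 'a::linorder)"
    and us: "set us \<subseteq> {..<K}" "u \<in> set us"
  shows "rank (map (\<lambda>u. (e u, pred u)) us) (e u) = card {v \<in> set us. v < u}"
proof -
  have "{y \<in> elements (map (\<lambda>u. (e u, pred u)) us). y < e u} = e ` {v \<in> set us. v < u}"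
    using us strict_mono_on_less[OF e]
    by (auto simp: elements_def image_image subset_iff)
  moreover have "inj_on e {v \<in> set us. v < u}"
    by (rule inj_on_subset[OF strict_mono_on_imp_inj_on[OF e]]) (use us in auto)
  ultimately show ?thesis
    by (simp add: rank_def card_image)
qed

section \<open>Counting items and scoring segments\<close>

text \<open>Half-open intervals make counts additive at a common endpoint, just as the widths
  \<open>M b - M a\<close> are.\<close>

definition cnt :: "nat set \<Rightarrow> nat \<Rightarrow> nat \<Rightarrow> nat" where
  "cnt S a b = card (S \<inter> {a..<b})"

lemma cnt_split: "a \<le> m \<Longrightarrow> m \<le> b \<Longrightarrow> cnt S a b = cnt S a m + cnt S m b"
  unfolding cnt_def
  by (subst card_Un_disjoint[symmetric]) (auto intro!: arg_cong[where f = card])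

lemma cnt_insert:
  assumes "x \<notin> S"
  shows "cnt (insert x S) a b = cnt S a b + (if a \<le> x \<and> x < b then 1 else 0)"
  using assms by (simp add: cnt_def)

lemma cnt_mono: "a \<le> a' \<Longrightarrow> b' \<le> b \<Longrightarrow> cnt S a' b' \<le> cnt S a b"
  unfolding cnt_def by (intro card_mono) auto

lemma cnt_pos: "a \<in> S \<Longrightarrow> a < b \<Longrightarrow> 0 < cnt S a b"
  unfolding cnt_def by (subst card_gt_0_iff) auto

lemma cnt_self [simp]: "cnt S a a = 0"
  by (simp add: cnt_def)

lemma cnt_eq_card_greaterThanAtMost:
  assumes "a \<in> S" "b \<in> S" "a \<le> b"
  shows "card (S \<inter> {a<..b}) = cnt S a b"
proof (cases "a = b")
  case False
  then have "S \<inter> {a..<b} = insert a (S \<inter> {a<..<b})" "S \<inter> {a<..b} = insert b (S \<inter> {a<..<b})"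
    using assms by auto
  then show ?thesis
    by (simp add: cnt_def)
qed simp

lemma cnt_le_width:
  assumes "strict_mono_on S M" "a \<in> S" "b \<in> S" "a \<le> b"
  shows "cnt S a b + M a \<le> M b"
proof -
  have "M ` (S \<inter> {a..<b}) \<subseteq> {M a..<M b}"
    using strict_mono_onD[OF assms(1)] strict_mono_on_leD[OF assms(1)] assms(2,3) by auto
  then have "card (M ` (S \<inter> {a..<b})) \<le> M b - M a"
    using card_mono[of "{M a..<M b}"] by fastforce
  moreover have "inj_on M (S \<inter> {a..<b})"
    using strict_mono_on_imp_inj_on[OF assms(1)] by (rule inj_on_subset) auto
  ultimately show ?thesis
    using strict_mono_on_leD[OF assms] by (simp add: cnt_def card_image)
qed

text \<open>Discrete intermediate values: passing to the next item raises the count by exactly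
  one.\<close>

lemma item_of_rank:
  assumes "a \<in> S" "b \<in> S" "a \<le> b" "j \<le> cnt S a b"
  obtains m where "m \<in> S" "a \<le> m" "m \<le> b" "cnt S a m = j"
proof -
  have "\<exists>m\<in>S. a \<le> m \<and> m \<le> b \<and> cnt S a m = j"
    using assms(4)
  proof (induction j)
    case 0
    then show ?case
      using assms by (intro bexI[of _ a]) auto
  next
    case (Suc j)
    then obtain m where m: "m \<in> S" "a \<le> m" "m \<le> b" "cnt S a m = j"
      by auto
    define m' where "m' = Min (S \<inter> {m<..b})"
    have "m \<noteq> b"
      using m Suc.prems by auto
    then have "S \<inter> {m<..b} \<noteq> {}"
      using m assms by auto
    then have m': "m' \<in> S \<inter> {m<..b}"
      unfolding m'_def by (intro Min_in) auto
    have "S \<inter> {m..<m'} = {m}"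
    proof -
      have "\<not> v < m'" if "v \<in> S" "m < v" for v
      proof
        assume "v < m'"
        then have "v \<in> S \<inter> {m<..b}"
          using that m' by auto
        then have "m' \<le> v"
          unfolding m'_def by (intro Min_le) auto
        then show False
          using \<open>v < m'\<close> by simp
      qed
      then show ?thesis
        using m m' by force
    qed
    then have "cnt S a m' = Suc j"
      using cnt_split[of a m m' S] m m' by (simp add: cnt_def)
    then show ?case
      using m m' by (intro bexI[of _ m']) auto
  qed
  then show ?thesis
    using that by blast
qed

text \<open>The logarithm of the density \<open>k / w\<close> plus a bonus
  \<open>\<alpha> * ln k\<close> for size.\<close>

definition log_score :: "real \<Rightarrow> real \<Rightarrow> real \<Rightarrow> real" where
  "log_score \<alpha> k w = (1 + \<alpha>) * ln k - ln w"

section \<open>Growth of logarithms under one insertion\<close>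

lemma ln_Suc_diff_ge:
  assumes "(0::real) < c"
  shows "1 / (c + 1) \<le> ln (c + 1) - ln c"
proof -
  have "ln (c / (c + 1)) \<le> c / (c + 1) - 1"
    using assms by (intro ln_le_minus_one) auto
  also have "\<dots> = - (1 / (c + 1))"
    using assms by (simp add: field_simps)
  finally show ?thesis
    using assms by (simp add: ln_div)
qed

lemma ln_Suc_diff_le:
  assumes "(0::real) < c"
  shows "ln (c + 1) - ln c \<le> 1 / c"
proof -
  have "ln ((c + 1) / c) \<le> (c + 1) / c - 1"
    using assms by (intro ln_le_minus_one) auto
  also have "\<dots> = 1 / c"
    using assms by (simp add: field_simps)
  finally show ?thesis
    using assms by (simp add: ln_div)
qed

lemma ln_Suc_diff_antimono:
  assumes "(0::real) < c" "c \<le> C"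
  shows "ln (C + 1) - ln C \<le> ln (c + 1) - ln c"
proof -
  have "(C + 1) / C \<le> (c + 1) / c"
    using assms by (simp add: field_simps)
  then have "ln ((C + 1) / C) \<le> ln ((c + 1) / c)"
    using assms by (intro ln_mono) auto
  then show ?thesis
    using assms by (simp add: ln_div)
qed

text \<open>The increments are about \<open>1 / c\<close> and \<open>1 / C\<close>; as
  \<open>c\<close> is at most a multiple of \<open>k\<close> while \<open>C - c\<close> is at least
  \<open>k / 2\<close>, they differ by at least a constant over \<open>k\<close>.\<close>

lemma ln_Suc_diff_gap:
  fixes c C k :: real
  assumes "16 \<le> k" "k \<le> c" "4 * c \<le> 5 * k" "2 * c + k \<le> 2 * C"
  shows "1 / (10 * k) \<le> (ln (c + 1) - ln c) - (ln (C + 1) - ln C)"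
proof -
  \<comment> \<open>\<open>s\<close> is the distance \<open>k / 2\<close> reduced by
    \<open>k / 16\<close>, which is at least \<open>1\<close> and so absorbs the step from
    \<open>c\<close> to \<open>u\<close>.\<close>
  define u s where "u = c + 1" and "s = 7 * k / 16"
  have u: "0 < u" "u \<le> 21 * k / 16" and s: "0 < s" and C: "u + s \<le> C"
    using assms by (auto simp: u_def s_def)
  have "u * (u + s) \<le> (21 * k / 16) * (7 * k / 4)"
    using u s by (intro mult_mono) (auto simp: s_def)
  also have "\<dots> \<le> s * (10 * k)"
    by (simp add: s_def)
  finally have "s / (s * (10 * k)) \<le> s / (u * (u + s))"
    using assms u s by (intro divide_left_mono) auto
  then have "1 / (10 * k) \<le> s / (u * (u + s))"
    using s by simp
  also have "\<dots> = 1 / u - 1 / (u + s)"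
    using u s by (simp add: field_simps)
  also have "\<dots> \<le> 1 / u - 1 / C"
    using u s C by (simp add: frac_le)
  also have "\<dots> \<le> (ln (c + 1) - ln c) - (ln (C + 1) - ln C)"
    using ln_Suc_diff_ge[of c] ln_Suc_diff_le[of C] assms by (simp add: u_def)
  finally show ?thesis .
qed

text \<open>A side part with an eighth of the items that does not beat the whole is denser by at
  most a factor \<open>8 powr \<alpha>\<close>, so it occupies almost its proportional share of
  slots. Hence the middle gets at most \<open>1 + 3 * \<alpha>\<close> times its share. This costs
  \<open>3 * \<alpha>\<close>, and the smaller size bonus at most \<alpha> more.\<close>

lemma log_score_middle:
  fixes k k1 k2 k3 w w1 w2 w3 \<alpha> :: real
  assumes \<alpha>: "0 < \<alpha>" and k: "k = k1 + k2 + k3" and w: "w = w1 + w2 + w3"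
    and pos: "0 < k" "0 < w1" "0 < w2" "0 < w3"
    and big: "k \<le> 8 * k1" "k \<le> 2 * k2" "k \<le> 8 * k3"
    and max: "log_score \<alpha> k1 w1 \<le> log_score \<alpha> k w" "log_score \<alpha> k3 w3 \<le> log_score \<alpha> k w"
  shows "log_score \<alpha> k w - 4 * \<alpha> \<le> log_score \<alpha> k2 w2"
proof -
  have w0: "0 < w"
    using pos w by simp
  have ln8: "ln (8::real) \<le> 3"
    using ln_2_less_1 ln_realpow[of "2::real" 3] by simp
  have side: "w * x / k * (1 - 3 * \<alpha>) \<le> y"
    if x: "k \<le> 8 * x" and y: "0 < y" and m: "log_score \<alpha> x y \<le> log_score \<alpha> k w" for x y
  proof -
    have x0: "0 < x"
      using x pos by linarith
    have "ln k \<le> ln (8 * x)"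
      using x pos by (intro ln_mono) auto
    then have "ln k \<le> 3 + ln x"
      using ln8 x0 by (simp add: ln_mult)
    then have "\<alpha> * (ln k - ln x) \<le> \<alpha> * 3"
      using \<alpha> by (intro mult_left_mono) auto
    then have "ln (w * x / k) - 3 * \<alpha> \<le> ln y"
      using m w0 x0 pos by (simp add: log_score_def ln_mult ln_div algebra_simps)
    then have "exp (ln (w * x / k) + - 3 * \<alpha>) \<le> exp (ln y)"
      by simp
    then have "w * x / k * exp (- 3 * \<alpha>) \<le> y"
      using w0 x0 pos y unfolding exp_add by simp
    moreover have "1 - 3 * \<alpha> \<le> exp (- 3 * \<alpha>)"
      using exp_ge_add_one_self[of "- 3 * \<alpha>"] by simp
    then have "w * x / k * (1 - 3 * \<alpha>) \<le> w * x / k * exp (- 3 * \<alpha>)"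
      using w0 x0 pos by (intro mult_left_mono) auto
    ultimately show ?thesis
      by linarith
  qed
  have k2: "0 < k2"
    using big pos by linarith
  have "w2 \<le> w - (w * k1 / k * (1 - 3 * \<alpha>) + w * k3 / k * (1 - 3 * \<alpha>))"
    using side[of k1 w1] side[of k3 w3] big pos max w by simp
  also have "\<dots> = w / k * (k - (k1 + k3) * (1 - 3 * \<alpha>))"
    using pos by (simp add: field_simps)
  also have "\<dots> = w / k * (k2 + 3 * \<alpha> * (k - k2))"
    using k by (simp add: algebra_simps)
  also have "\<dots> \<le> w / k * (k2 + 3 * \<alpha> * k2)"
    using w0 pos \<alpha> big by (intro mult_left_mono add_left_mono) auto
  also have "\<dots> = (w / k * k2) * (1 + 3 * \<alpha>)"
    by (simp add: algebra_simps)
  finally have "ln w2 \<le> ln ((w / k * k2) * (1 + 3 * \<alpha>))"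
    using pos by (intro ln_mono) auto
  also have "\<dots> = ln w - ln k + ln k2 + ln (1 + 3 * \<alpha>)"
    using w0 pos k2 \<alpha> by (simp add: ln_mult ln_div)
  also have "\<dots> \<le> ln w - ln k + ln k2 + 3 * \<alpha>"
    using ln_add_one_self_le_self[of "3 * \<alpha>"] \<alpha> by simp
  finally have lnw2: "ln w2 \<le> ln w - ln k + ln k2 + 3 * \<alpha>" .
  have "ln k \<le> ln (2 * k2)"
    using big pos by (intro ln_mono) auto
  then have "ln k \<le> 1 + ln k2"
    using ln_2_less_1 k2 by (simp add: ln_mult)
  then have "\<alpha> * ln k \<le> \<alpha> * (1 + ln k2)"
    using \<alpha> by (intro mult_left_mono) auto
  then show ?thesis
    using lnw2 by (simp add: log_score_def algebra_simps)
qed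

text \<open>One of two complementary parts is at least as dense as the whole; with a third of the
  items it loses at most \<open>\<alpha> * ln 3\<close> of the size bonus.\<close>

lemma log_score_half:
  fixes k k1 k2 w w1 w2 \<alpha> :: real
  assumes \<alpha>: "0 < \<alpha>" and k: "k = k1 + k2" and w: "w = w1 + w2"
    and pos: "0 < k" "0 < w1" "0 < w2"
    and big: "k \<le> 3 * k1" "k \<le> 3 * k2"
  shows "log_score \<alpha> k w - 2 * \<alpha> \<le> log_score \<alpha> k1 w1 \<or> log_score \<alpha> k w - 2 * \<alpha> \<le> log_score \<alpha> k2 w2"
proof -
  have part: "log_score \<alpha> k w - 2 * \<alpha> \<le> log_score \<alpha> x y"
    if x: "k \<le> 3 * x" and y: "0 < y" and d: "k * y \<le> x * w" for x y
  proof -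
    have w0: "0 < w" and x0: "0 < x"
      using pos w x by auto
    have "ln (k * y) \<le> ln (x * w)"
      using d pos y by (intro ln_mono) auto
    then have dens: "ln k + ln y \<le> ln x + ln w"
      using pos y x0 w0 by (simp add: ln_mult)
    have "ln (3::real) \<le> 2"
      using ln_le_minus_one[of "3::real"] by simp
    moreover have "ln k \<le> ln (3 * x)"
      using x pos by (intro ln_mono) auto
    ultimately have "ln k \<le> 2 + ln x"
      using x0 by (simp add: ln_mult)
    then have "\<alpha> * ln k \<le> \<alpha> * (2 + ln x)"
      using \<alpha> by (intro mult_left_mono) auto
    then show ?thesis
      using dens by (simp add: log_score_def algebra_simps)
  qed
  have "k * w1 \<le> k1 * w \<or> k * w2 \<le> k2 * w"
    unfolding k w by (auto simp: algebra_simps)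
  then show ?thesis
    using part[of k1 w1] part[of k2 w2] big pos by auto
qed

section \<open>Chains of segments\<close>

text \<open>
  A lazy labeling \<open>M\<close> follows the labelings \<open>lab\<close> of the structure but changes only labels in a run
  \<open>R\<close> of consecutive items around the new one. The remaining differences are movements that
  the structure has already paid for.
\<close>

lemma lazy_labeling_step:
  assumes fin: "finite S" and x: "x \<notin> S"
    and M: "number_labeling m S M" and lab': "number_labeling m (insert x S) lab'"
  obtains R where "x \<in> R" "R \<subseteq> insert x S"
    "\<And>v w. v \<in> R \<Longrightarrow> w \<in> S \<Longrightarrow> v \<le> w \<and> w \<le> x \<or> x \<le> w \<and> w \<le> v \<Longrightarrow> w \<in> R"
    "number_labeling m (insert x S) (\<lambda>v. if v \<in> R then lab' v else M v)"
    "card R + card {v \<in> insert x S. (if v \<in> R then lab' v else M v) \<noteq> lab' v}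
       \<le> 1 + card {v \<in> S. M v \<noteq> lab v} + card {v \<in> S. lab' v \<noteq> lab v}"
proof -
  \<comment> \<open>The run extends from \<open>x\<close> in both directions up to the nearest items
    at which \<open>M\<close> already agrees with \<open>lab'\<close>.\<close>
  define R where "R = {v \<in> insert x S. \<forall>w\<in>S. (v \<le> w \<and> w \<le> x \<or> x \<le> w \<and> w \<le> v) \<longrightarrow> M w \<noteq> lab' w}"
  define M' where "M' = (\<lambda>v. if v \<in> R then lab' v else M v)"
  have xR: "x \<in> R"
    using x by (auto simp: R_def)
  have sub: "R \<subseteq> insert x S"
    by (auto simp: R_def)
  have conv: "w \<in> R" if "v \<in> R" "w \<in> S" "v \<le> w \<and> w \<le> x \<or> x \<le> w \<and> w \<le> v" for v w
    using that unfolding R_def by auto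
  have smM: "strict_mono_on S M" and smL: "strict_mono_on (insert x S) lab'"
    using M lab' by (auto simp: number_labeling_def)
  have smM': "strict_mono_on (insert x S) M'"
  proof (rule strict_mono_onI)
    fix v w assume vw: "v \<in> insert x S" "w \<in> insert x S" "v < w"
    consider "v \<in> R" "w \<in> R" | "v \<notin> R" "w \<notin> R" | "v \<in> R" "w \<notin> R" | "v \<notin> R" "w \<in> R"
      by blast
    then show "M' v < M' w"
    proof cases
      case 1
      then show ?thesis
        using strict_mono_onD[OF smL] vw by (simp add: M'_def)
    next
      case 2
      then have "v \<in> S" "w \<in> S"
        using xR vw by auto
      then show ?thesis
        using 2 strict_mono_onD[OF smM] vw by (simp add: M'_def)
    next
      case 3
      then have wS: "w \<in> S"
        using xR vw by auto
      then have "x < w"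
        using conv[of v w] 3 vw xR by force
      \<comment> \<open>The item \<open>z\<close> has the same label in both labelings, so it
        separates the new label of \<open>v\<close> from the old label of \<open>w\<close>.\<close>
      then obtain z where z: "z \<in> S" "x \<le> z" "z \<le> w" "M z = lab' z"
        using 3 vw by (auto simp: R_def)
      then have "v < z"
        using 3 x by (force simp: R_def)
      then have "lab' v < lab' z"
        using strict_mono_onD[OF smL] vw z by auto
      also have "lab' z \<le> M w"
        using strict_mono_on_leD[OF smM] z wS by metis
      finally show ?thesis
        using 3 by (simp add: M'_def)
    next
      case 4
      then have vS: "v \<in> S"
        using xR vw by auto
      then have "v < x"
        using conv[of w v] 4 vw xR by force
      then obtain z where z: "z \<in> S" "z \<le> x" "v \<le> z" "M z = lab' z"
        using 4 vw by (auto simp: R_def)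
      then have "z < w"
        using 4 x by (force simp: R_def)
      then have "lab' z < lab' w"
        using strict_mono_onD[OF smL] vw z by auto
      moreover have "M v \<le> lab' z"
        using strict_mono_on_leD[OF smM] z vS by metis
      ultimately show ?thesis
        using 4 by (simp add: M'_def)
    qed
  qed
  \<comment> \<open>An item whose lazy label differs from \<open>lab'\<close> was either out of date
    before or has just been moved by the structure. Items of the run are up to date afterwards, so
    the two sets on the left are disjoint.\<close>
  have "R - {x} \<union> {v \<in> insert x S. M' v \<noteq> lab' v} \<subseteq> {v \<in> S. M v \<noteq> lab v} \<union> {v \<in> S. lab' v \<noteq> lab v}"
    using xR unfolding M'_def R_def by auto
  then have "card (R - {x} \<union> {v \<in> insert x S. M' v \<noteq> lab' v})
      \<le> card ({v \<in> S. M v \<noteq> lab v} \<union> {v \<in> S. lab' v \<noteq> lab v})"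
    using fin by (intro card_mono) auto
  also have "\<dots> \<le> card {v \<in> S. M v \<noteq> lab v} + card {v \<in> S. lab' v \<noteq> lab v}"
    by (rule card_Un_le)
  also have "card (R - {x} \<union> {v \<in> insert x S. M' v \<noteq> lab' v})
      = card (R - {x}) + card {v \<in> insert x S. M' v \<noteq> lab' v}"
    using fin finite_subset[OF sub] by (intro card_Un_disjoint) (auto simp: M'_def)
  finally have "card R + card {v \<in> insert x S. M' v \<noteq> lab' v}
       \<le> 1 + card {v \<in> S. M v \<noteq> lab v} + card {v \<in> S. lab' v \<noteq> lab v}"
    using xR finite_subset[OF sub] fin by (simp add: card_Diff_singleton)
  moreover have "number_labeling m (insert x S) M'"
    using smM' M lab' xR unfolding number_labeling_def M'_def by auto
  ultimately show ?thesis
    using that xR sub conv unfolding M'_def by blast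
qed

text \<open>
  \<open>Level a p q b k e\<close> is an outer segment \<open>[a, b)\<close> with an inner segment \<open>[p, q)\<close>. It had
  \<open>k\<close> items at its creation and has received \<open>e\<close> insertions since. The inner segment grows when
  its boundaries are moved, so that no item of \<open>[a, p]\<close> and \<open>[q, b]\<close> has moved since the creation.
  A list of levels is a nested chain with the innermost segment first.
\<close>

datatype level = Level nat nat nat nat nat nat

fun grow :: "level \<Rightarrow> level" where
  "grow (Level a p q b k e) = Level a p q b k (Suc e)"

fun inner_lo :: "nat \<Rightarrow> level list \<Rightarrow> nat" where
  "inner_lo P [] = P"
| "inner_lo P (Level a p q b k e # ls) = p"

fun inner_hi :: "nat \<Rightarrow> level list \<Rightarrow> nat" where
  "inner_hi Q [] = Q"
| "inner_hi Q (Level a p q b k e # ls) = q"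

fun outer_cnt :: "nat \<Rightarrow> nat \<Rightarrow> nat set \<Rightarrow> level list \<Rightarrow> nat" where
  "outer_cnt P Q S [] = cnt S P Q"
| "outer_cnt P Q S (Level a p q b k e # ls) = cnt S a b"

lemma level_list_cases:
  obtains "ls = []" | a p q b k e ls' where "ls = Level a p q b k e # ls'"
  by (metis level.exhaust list.exhaust)

lemma inner_grow [simp]:
  "inner_lo P (map grow ls) = inner_lo P ls" "inner_hi Q (map grow ls) = inner_hi Q ls"
  by (cases ls rule: level_list_cases; simp)+

text \<open>\<alpha> weighs size against density, \<kappa> is the saturation threshold, \<phi> a
  lower bound for the score of the block and \<open>d\<close> the depth. After a loss of
  \<open>6 * \<alpha>\<close> on each of \<open>d\<close> levels, \<open>\<phi>_ge\<close> still
  leaves a score that only segments with at least \<open>kmin\<close> items can reach.\<close>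

locale segment_chains =
  fixes \<alpha> \<kappa> \<phi> :: real and kmin d :: nat
  assumes \<alpha>_pos: "0 < \<alpha>" and \<kappa>_pos: "0 < \<kappa>" and \<kappa>_le: "\<kappa> \<le> 1 / 4"
    and kmin_ge: "32 \<le> kmin" and \<kappa>_kmin: "2 \<le> \<kappa> * kmin"
    and \<phi>_ge: "\<alpha> * ln kmin \<le> \<phi> - 6 * \<alpha> * d"
begin

section \<open>Invariants and potential of a chain\<close>

definition score :: "nat set \<Rightarrow> (nat \<Rightarrow> nat) \<Rightarrow> nat \<Rightarrow> nat \<Rightarrow> real" where
  "score S M a b = log_score \<alpha> (cnt S a b) (real (M b) - real (M a))"

text \<open>The margins \<open>[a, p)\<close> and \<open>[q, b)\<close> hold between an eighth and a
  quarter of \<open>k\<close> items. The last conjunct covers every admissible future position of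
  the inner boundaries, so that they can retreat outwards later.\<close>

fun level_ok :: "nat set \<Rightarrow> (nat \<Rightarrow> nat) \<Rightarrow> level \<Rightarrow> bool" where
  "level_ok S M (Level a p q b k e) \<longleftrightarrow>
     a \<in> S \<and> p \<in> S \<and> q \<in> S \<and> b \<in> S \<and> a \<le> p \<and> p < q \<and> q \<le> b \<and> kmin \<le> k \<and>
     k \<le> 8 * cnt S a p \<and> k \<le> 8 * cnt S q b \<and>
     cnt S a p \<le> k div 4 \<and> cnt S q b \<le> k div 4 \<and> cnt S a b = k + e \<and>
     (\<forall>p'\<in>S. \<forall>q'\<in>S. a \<le> p' \<longrightarrow> p' \<le> p \<longrightarrow> q \<le> q' \<longrightarrow> q' \<le> b \<longrightarrow>
        k \<le> 8 * cnt S a p' \<longrightarrow> k \<le> 8 * cnt S q' b \<longrightarrow>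
        score S M a b - 4 * \<alpha> \<le> score S M p' q')"

fun outer_score :: "nat set \<Rightarrow> (nat \<Rightarrow> nat) \<Rightarrow> level list \<Rightarrow> real" where
  "outer_score S M [] = \<phi>"
| "outer_score S M (Level a p q b k e # ls) = score S M a b"

text \<open>The gap of \<open>k / 2\<close> items to the enclosing segment survives because an
  insertion counts on both sides. The loss consists of \<open>4 * \<alpha>\<close> for passing to
  the inner segment and \<open>2 * \<alpha>\<close> for choosing a smaller one inside it; insertions
  before saturation win back \<open>1 / (10 * k)\<close> each.\<close>

fun linked :: "nat \<Rightarrow> nat \<Rightarrow> nat set \<Rightarrow> (nat \<Rightarrow> nat) \<Rightarrow> level \<Rightarrow> level list \<Rightarrow> bool" where
  "linked P Q S M (Level a p q b k e) ls \<longleftrightarrow>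
     inner_lo P ls \<le> a \<and> b \<le> inner_hi Q ls \<and>
     2 * cnt S a b + k \<le> 2 * outer_cnt P Q S ls \<and>
     outer_score S M ls - 6 * \<alpha> + min e (\<kappa> * k) / (10 * real k) \<le> score S M a b"

fun chain_ok :: "nat \<Rightarrow> nat \<Rightarrow> nat set \<Rightarrow> (nat \<Rightarrow> nat) \<Rightarrow> level list \<Rightarrow> bool" where
  "chain_ok P Q S M [] \<longleftrightarrow> P \<in> S \<and> Q \<in> S \<and> P < Q"
| "chain_ok P Q S M (l # ls) \<longleftrightarrow> level_ok S M l \<and> linked P Q S M l ls \<and> chain_ok P Q S M ls"

text \<open>The summand \<open>1\<close> asks that the next insertion still counts in full towards
  \<open>min e (\<kappa> * k)\<close>.\<close>

fun unsaturated :: "level list \<Rightarrow> nat" where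
  "unsaturated [] = 0"
| "unsaturated (Level a p q b k e # ls) = (if real e + 1 \<le> \<kappa> * k then 1 else 0) + unsaturated ls"

text \<open>The progress of each level, minus \<open>16 * \<kappa>\<close> for every margin item
  lost since both margins had \<open>k div 4\<close> items. Movements have been charged for these
  items already.\<close>

fun potential :: "nat set \<Rightarrow> level list \<Rightarrow> real" where
  "potential S [] = 0"
| "potential S (Level a p q b k e # ls) =
     min e (\<kappa> * k) - 16 * \<kappa> * (2 * real (k div 4) - real (cnt S a p) - real (cnt S q b)) + potential S ls"

lemma inner_in:
  "chain_ok P Q S M ls \<Longrightarrow> inner_lo P ls \<in> S \<and> inner_hi Q ls \<in> S \<and> inner_lo P ls < inner_hi Q ls"
  by (cases ls rule: level_list_cases) auto

text \<open>The widths concerned stay fixed while every segment gains one item, and the logarithm of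
  a smaller count grows more. So an inner segment cannot fall further behind the outer one.\<close>

lemma level_ok_step:
  assumes ok: "level_ok S M (Level a p q b k e)" and x: "x \<notin> S" "p' < x" "x < q'"
    and p': "p' \<in> S" "a \<le> p'" "p' \<le> p" "k \<le> 8 * cnt S a p'"
    and q': "q' \<in> S" "q \<le> q'" "q' \<le> b" "k \<le> 8 * cnt S q' b"
    and M': "\<And>v. v \<in> S \<Longrightarrow> v \<le> p' \<or> q' \<le> v \<Longrightarrow> M' v = M v"
  shows "level_ok (insert x S) M' (Level a p' q' b k (Suc e))"
proof -
  have cnts: "cnt (insert x S) a v = cnt S a v" if "v \<le> p'" for v
    using that x by (simp add: cnt_insert)
  have cnts': "cnt (insert x S) v b = cnt S v b" if "q' \<le> v" for v
    using that x by (simp add: cnt_insert)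
  have sc: "score (insert x S) M' a b - 4 * \<alpha> \<le> score (insert x S) M' u v"
    if uv: "u \<in> S" "v \<in> S" "a \<le> u" "u \<le> p'" "q' \<le> v" "v \<le> b" "k \<le> 8 * cnt S a u" "k \<le> 8 * cnt S v b"
    for u v
  proof -
    have old: "score S M a b - 4 * \<alpha> \<le> score S M u v"
      using ok uv p' q' by auto
    have c: "0 < cnt S u v" "cnt S u v \<le> cnt S a b"
      using uv x cnt_pos[of u S v] cnt_mono[of a u v b S] by auto
    have "(1 + \<alpha>) * (ln (real (cnt S a b) + 1) - ln (cnt S a b))
        \<le> (1 + \<alpha>) * (ln (real (cnt S u v) + 1) - ln (cnt S u v))"
      using c \<alpha>_pos by (intro mult_left_mono ln_Suc_diff_antimono) auto
    moreover have "M' a = M a" "M' b = M b" "M' u = M u" "M' v = M v"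
      using M' ok uv p' q' by auto
    moreover have "cnt (insert x S) u v = cnt S u v + 1" "cnt (insert x S) a b = cnt S a b + 1"
      using x uv p' q' by (auto simp: cnt_insert)
    ultimately show ?thesis
      using old by (simp add: score_def log_score_def algebra_simps)
  qed
  have "cnt S a p' \<le> cnt S a p" "cnt S q' b \<le> cnt S q b"
    using p' q' by (auto intro: cnt_mono)
  moreover have "cnt (insert x S) a b = k + Suc e"
    using ok x p' q' by (auto simp: cnt_insert)
  ultimately show ?thesis
    using ok x p' q' sc by (auto simp: cnts cnts')
qed

text \<open>Before saturation \<open>c \<le> 5 * k / 4\<close>, and the gap between the logarithmic
  increments pays for \<open>1 / (10 * k)\<close>. Afterwards it suffices that the smaller segment
  gains no less than the enclosing one.\<close>

lemma linked_step_arith: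
  fixes c C :: nat
  assumes c: "c = k + e" and k: "32 \<le> k" and C: "2 * c + k \<le> 2 * C"
    and old: "os - 6 * \<alpha> + min e (\<kappa> * k) / (10 * real k) \<le> log_score \<alpha> c w"
    and os': "os' \<le> os + (1 + \<alpha>) * (ln (real C + 1) - ln C)"
  shows "os' - 6 * \<alpha> + min (Suc e) (\<kappa> * k) / (10 * real k) \<le> log_score \<alpha> (real c + 1) w"
proof -
  have c0: "0 < real c" "real c \<le> C"
    using c k C by auto
  have diff: "log_score \<alpha> (real c + 1) w = log_score \<alpha> c w + (1 + \<alpha>) * (ln (real c + 1) - ln c)"
    by (simp add: log_score_def algebra_simps)
  define g where "g = (ln (real c + 1) - ln c) - (ln (real C + 1) - ln C)"
  have g0: "0 \<le> g"
    unfolding g_def using ln_Suc_diff_antimono[OF c0] by simp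
  have "min (Suc e) (\<kappa> * k) / (10 * real k) \<le> min e (\<kappa> * k) / (10 * real k) + g"
  proof (cases "real e < \<kappa> * k")
    case True
    also have "\<kappa> * k \<le> 1 / 4 * k"
      using \<kappa>_le by (intro mult_right_mono) auto
    finally have "4 * real e \<le> k"
      by simp
    then have "1 / (10 * real k) \<le> g"
      unfolding g_def using c k C by (intro ln_Suc_diff_gap) auto
    moreover have "min (Suc e) (\<kappa> * k) \<le> min e (\<kappa> * k) + 1"
      by auto
    then have "min (Suc e) (\<kappa> * k) / (10 * real k) \<le> (min e (\<kappa> * k) + 1) / (10 * real k)"
      by (intro divide_right_mono) auto
    ultimately show ?thesis
      by (simp add: add_divide_distrib)
  next
    case False
    then have "min (Suc e) (\<kappa> * k) = min e (\<kappa> * k)"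
      by auto
    then show ?thesis
      using g0 by simp
  qed
  moreover have "g \<le> (1 + \<alpha>) * g"
    using g0 \<alpha>_pos by (simp add: mult_le_cancel_right1)
  ultimately show ?thesis
    using old os' unfolding diff g_def by (simp add: algebra_simps)
qed

lemma outer_step:
  assumes "chain_ok P Q S M ls" "x \<notin> S" "inner_lo P ls < x" "x < inner_hi Q ls"
    and "\<And>v. v \<in> S \<Longrightarrow> v \<le> inner_lo P ls \<or> inner_hi Q ls \<le> v \<Longrightarrow> M' v = M v"
  shows "outer_cnt P Q (insert x S) (map grow ls) = outer_cnt P Q S ls + 1"
    and "outer_score (insert x S) M' (map grow ls)
      \<le> outer_score S M ls + (1 + \<alpha>) * (ln (real (outer_cnt P Q S ls) + 1) - ln (outer_cnt P Q S ls))"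
proof -
  show "outer_cnt P Q (insert x S) (map grow ls) = outer_cnt P Q S ls + 1"
    using assms by (cases ls rule: level_list_cases) (auto simp: cnt_insert)
  have "0 < cnt S P Q \<Longrightarrow> 0 \<le> (1 + \<alpha>) * (ln (real (cnt S P Q) + 1) - ln (cnt S P Q))"
    using \<alpha>_pos by simp
  then show "outer_score (insert x S) M' (map grow ls)
      \<le> outer_score S M ls + (1 + \<alpha>) * (ln (real (outer_cnt P Q S ls) + 1) - ln (outer_cnt P Q S ls))"
    using assms cnt_pos[of P S Q]
    by (cases ls rule: level_list_cases) (auto simp: cnt_insert score_def log_score_def algebra_simps)
qed

lemma linked_step:
  assumes l: "level_ok S M (Level a p q b k e)" "linked P Q S M (Level a p q b k e) ls"
    and ls: "chain_ok P Q S M ls"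
    and x: "x \<notin> S" "a < x" "x < b" and ab: "M' a = M a" "M' b = M b"
    and M': "\<And>v. v \<in> S \<Longrightarrow> v \<le> inner_lo P ls \<or> inner_hi Q ls \<le> v \<Longrightarrow> M' v = M v"
  shows "linked P Q (insert x S) M' (Level a p' q' b k (Suc e)) (map grow ls)"
proof -
  have xin: "inner_lo P ls < x" "x < inner_hi Q ls"
    using l x by auto
  note os = outer_step[OF ls x(1) xin M']
  have c: "cnt (insert x S) a b = cnt S a b + 1"
    using x by (simp add: cnt_insert)
  have "outer_score (insert x S) M' (map grow ls) - 6 * \<alpha> + min (Suc e) (\<kappa> * k) / (10 * real k)
      \<le> log_score \<alpha> (real (cnt S a b) + 1) (real (M b) - real (M a))"
    using l kmin_ge os(2)
    by (intro linked_step_arith[where os = "outer_score S M ls" and C = "outer_cnt P Q S ls"])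
      (auto simp: score_def)
  also have "\<dots> = score (insert x S) M' a b"
    by (simp add: score_def c ab add.commute)
  finally show ?thesis
    using l os(1) by (simp add: c)
qed

text \<open>This serves the levels around one that survives: no label changes at or beyond their
  inner boundaries, so they only grow, and each unsaturated one gains \<open>1\<close>.\<close>

lemma intact_chain:
  assumes "chain_ok P Q S M ls" and x: "x \<notin> S" "inner_lo P ls < x" "x < inner_hi Q ls"
    and M': "\<And>v. v \<in> S \<Longrightarrow> v \<le> inner_lo P ls \<or> inner_hi Q ls \<le> v \<Longrightarrow> M' v = M v"
  shows "chain_ok P Q (insert x S) M' (map grow ls) \<and>
    potential S ls + unsaturated ls \<le> potential (insert x S) (map grow ls)"
  using assms
proof (induction ls)
  case Nil
  then show ?case by simp
next
  case (Cons l ls)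
  obtain a p q b k e where l: "l = Level a p q b k e"
    by (cases l)
  have ok: "level_ok S M (Level a p q b k e)" and lk: "linked P Q S M (Level a p q b k e) ls"
    and ch: "chain_ok P Q S M ls"
    using Cons.prems(1) by (auto simp: l)
  have px: "p < x" "x < q"
    using Cons.prems by (auto simp: l)
  have M': "M' v = M v" if "v \<in> S" "v \<le> p \<or> q \<le> v" for v
    using Cons.prems(5) that by (simp add: l)
  have geo: "a \<le> p" "q \<le> b" "inner_lo P ls \<le> a" "b \<le> inner_hi Q ls" "a \<in> S" "b \<in> S"
    using ok lk by auto
  have IH: "chain_ok P Q (insert x S) M' (map grow ls) \<and>
    potential S ls + unsaturated ls \<le> potential (insert x S) (map grow ls)"
    using geo px ch M' Cons.prems(2) by (intro Cons.IH) auto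
  have "level_ok (insert x S) M' (Level a p q b k (Suc e))"
    using ok px M' Cons.prems(2) by (intro level_ok_step[OF ok]) auto
  moreover have "linked P Q (insert x S) M' (Level a p q b k (Suc e)) (map grow ls)"
    using geo px M' Cons.prems(2) by (intro linked_step[OF ok lk ch]) auto
  moreover have "cnt (insert x S) a p = cnt S a p" "cnt (insert x S) q b = cnt S q b"
    using px Cons.prems(2) by (auto simp: cnt_insert)
  ultimately show ?case
    using IH by (auto simp: l)
qed

text \<open>
  A run that destroys a level covers a constant fraction of its items outside the inner segment,
  except those that earlier runs covered, which the potential already accounts for. The segments of
  different levels between outer and inner boundary are disjoint, so every moved item pays for at
  most one level.
\<close>

lemma repair_chain:
  assumes "chain_ok P Q S M ls" and x: "x \<notin> S" "inner_lo P ls < x" "x < inner_hi Q ls"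
    and R: "finite R" "x \<in> R" "R \<subseteq> insert x S"
    and conv: "\<And>v w. v \<in> R \<Longrightarrow> w \<in> S \<Longrightarrow> v \<le> w \<and> w \<le> x \<or> x \<le> w \<and> w \<le> v \<Longrightarrow> w \<in> R"
    and M': "\<And>v. v \<in> S \<Longrightarrow> v \<notin> R \<Longrightarrow> M' v = M v"
  shows "\<exists>ls'. length ls' \<le> length ls \<and> chain_ok P Q (insert x S) M' ls' \<and>
    potential S ls + unsaturated ls
      \<le> potential (insert x S) ls' + 16 * \<kappa> * card (R - {inner_lo P ls<..<inner_hi Q ls})"
  using assms(1) x(2,3)
proof (induction ls)
  case Nil
  then show ?case
    using \<kappa>_pos by (intro exI[of _ "[]"]) auto
next
  case (Cons l ls)
  obtain a p q b k e where l: "l = Level a p q b k e"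
    by (cases l)
  have ok: "level_ok S M (Level a p q b k e)" and lk: "linked P Q S M (Level a p q b k e) ls"
    and ch: "chain_ok P Q S M ls"
    using Cons.prems(1) by (auto simp: l)
  have px: "p < x" "x < q"
    using Cons.prems by (auto simp: l)
  have geo: "a \<le> p" "q \<le> b" "inner_lo P ls \<le> a" "b \<le> inner_hi Q ls"
    "a \<in> S" "b \<in> S" "p \<in> S" "q \<in> S" "p < q"
    using ok lk by auto
  have k: "32 \<le> k" "cnt S a p \<le> k div 4" "cnt S q b \<le> k div 4"
    "k \<le> 8 * cnt S a p" "k \<le> 8 * cnt S q b"
    using ok kmin_ge by auto
  \<comment> \<open>Candidates for the new inner boundaries: items outside the run that leave an
    eighth of \<open>k\<close> items in the margin.\<close>
  define F where "F = {v \<in> S. a \<le> v \<and> v \<le> p \<and> k \<le> 8 * cnt S a v \<and> v \<notin> R}"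
  define G where "G = {v \<in> S. q \<le> v \<and> v \<le> b \<and> k \<le> 8 * cnt S v b \<and> v \<notin> R}"
  have fin: "finite F" "finite G"
    using finite_subset[of F "{..p}"] finite_subset[of G "{..b}"] by (auto simp: F_def G_def)
  define ind where "ind = (if real e + 1 \<le> \<kappa> * k then 1 else 0 :: real)"
  show ?case
  proof (cases "F \<noteq> {} \<and> G \<noteq> {}")
    case True
    \<comment> \<open>The innermost candidates lose the fewest margin items; every item skipped lies
      in the run.\<close>
    define p' where "p' = Max F"
    define q' where "q' = Min G"
    have "p' \<in> F" "q' \<in> G"
      using True fin by (auto simp: p'_def q'_def)
    then have p': "p' \<in> S" "a \<le> p'" "p' \<le> p" "k \<le> 8 * cnt S a p'" "p' \<notin> R"
      and q': "q' \<in> S" "q \<le> q'" "q' \<le> b" "k \<le> 8 * cnt S q' b" "q' \<notin> R"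
      by (auto simp: F_def G_def)
    have notR: "v \<notin> R" if "v \<in> S" "v \<le> p' \<or> q' \<le> v" for v
      using that conv[of v p'] conv[of v q'] p' q' px by auto
    have M'v: "M' v = M v" if "v \<in> S" "v \<le> p' \<or> q' \<le> v" for v
      using M' notR that by blast
    have rest: "chain_ok P Q (insert x S) M' (map grow ls) \<and>
      potential S ls + unsaturated ls \<le> potential (insert x S) (map grow ls)"
      using geo px p' q' x M'v by (intro intact_chain[OF ch]) auto
    have "level_ok (insert x S) M' (Level a p' q' b k (Suc e))"
      using p' q' px x M'v by (intro level_ok_step[OF ok]) auto
    moreover have "linked P Q (insert x S) M' (Level a p' q' b k (Suc e)) (map grow ls)"
      using geo px p' q' x M'v by (intro linked_step[OF ok lk ch]) auto
    ultimately have chain': "chain_ok P Q (insert x S) M' (Level a p' q' b k (Suc e) # map grow ls)"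
      using rest by simp
    have "S \<inter> {p'<..p} \<subseteq> R"
    proof
      fix v assume v: "v \<in> S \<inter> {p'<..p}"
      have "cnt S a p' \<le> cnt S a v"
        using v by (intro cnt_mono) auto
      moreover have "v \<notin> F"
        using v Max_ge[OF fin(1), of v] by (auto simp: p'_def)
      ultimately show "v \<in> R"
        using v p' by (auto simp: F_def)
    qed
    moreover have "S \<inter> {q..<q'} \<subseteq> R"
    proof
      fix v assume v: "v \<in> S \<inter> {q..<q'}"
      have "cnt S q' b \<le> cnt S v b"
        using v by (intro cnt_mono) auto
      moreover have "v \<notin> G"
        using v Min_le[OF fin(2), of v] by (auto simp: q'_def)
      ultimately show "v \<in> R"
        using v q' by (auto simp: G_def)
    qed
    ultimately have sub: "S \<inter> {p'<..p} \<union> S \<inter> {q..<q'} \<subseteq> R - {p<..<q}"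
      using geo by auto
    have "cnt S p' p + cnt S q q' = card (S \<inter> {p'<..p} \<union> S \<inter> {q..<q'})"
      using cnt_eq_card_greaterThanAtMost[OF p'(1) geo(7) p'(3)] geo
      by (subst card_Un_disjoint) (auto simp: cnt_def)
    also have "\<dots> \<le> card (R - {p<..<q})"
      using sub R by (intro card_mono) auto
    finally have r: "real (cnt S p' p) + real (cnt S q q') \<le> card (R - {p<..<q})"
      by linarith
    have "cnt S a p = cnt (insert x S) a p' + cnt S p' p"
      "cnt S q b = cnt S q q' + cnt (insert x S) q' b"
      using cnt_split[of a p' p S] cnt_split[of q q' b S] p' q' px x by (auto simp: cnt_insert)
    then have dep: "real (cnt S a p) + real (cnt S q b) \<le>
        real (cnt (insert x S) a p') + real (cnt (insert x S) q' b) + card (R - {p<..<q})"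
      using r by simp
    have "16 * \<kappa> * (real (cnt S a p) + real (cnt S q b)) \<le>
        16 * \<kappa> * (real (cnt (insert x S) a p') + real (cnt (insert x S) q' b) + card (R - {p<..<q}))"
      using \<kappa>_pos by (intro mult_left_mono[OF dep]) auto
    then have "16 * \<kappa> * (2 * real (k div 4) - real (cnt (insert x S) a p') - real (cnt (insert x S) q' b))
      \<le> 16 * \<kappa> * (2 * real (k div 4) - real (cnt S a p) - real (cnt S q b)) + 16 * \<kappa> * card (R - {p<..<q})"
      by (simp add: algebra_simps)
    moreover have "min e (\<kappa> * k) + ind \<le> min (Suc e) (\<kappa> * k)"
      by (auto simp: ind_def)
    moreover have "unsaturated (l # ls) = ind + unsaturated ls"
      by (simp add: l ind_def)
    ultimately have "potential S (l # ls) + unsaturated (l # ls)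
      \<le> potential (insert x S) (Level a p' q' b k (Suc e) # map grow ls)
        + 16 * \<kappa> * card (R - {p<..<q})"
      using rest unfolding l potential.simps by linarith
    then show ?thesis
      using chain' by (intro exI[of _ "Level a p' q' b k (Suc e) # map grow ls"]) (simp add: l)
  next
    case False
    \<comment> \<open>This is \<open>k / 8\<close> rounded up: the outermost \<open>j\<close> items
      of a margin leave too little room for a boundary, so the run need not cover them.\<close>
    define j where "j = (k + 7) div 8"
    \<comment> \<open>\<open>T\<close> consists of the items that the run must cover on the
      exhausted side; the other margin is bounded by \<open>k div 4\<close>. As \<open>T\<close>
      lies strictly within the enclosing inner segment, outer levels do not charge for it
      again.\<close>
    obtain T where T: "T \<subseteq> R" "T \<inter> {p<..<q} = {}" "T \<subseteq> {inner_lo P ls<..<inner_hi Q ls}"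
      and depT: "cnt S a p + cnt S q b \<le> card T + j + k div 4"
    proof (cases "F = {}")
      case True
      have "j \<le> cnt S a p"
        using k by (auto simp: j_def)
      then obtain v0 where v0: "v0 \<in> S" "a \<le> v0" "v0 \<le> p" "cnt S a v0 = j"
        using item_of_rank[of a S p j] geo by auto
      \<comment> \<open>The item \<open>a\<close> may be the inner boundary of the enclosing level
        and must stay outside \<open>T\<close>.\<close>
      have "v0 \<noteq> a"
        using v0 k by (auto simp: j_def)
      have "S \<inter> {v0..<p} \<subseteq> R"
      proof
        fix v assume v: "v \<in> S \<inter> {v0..<p}"
        then have "j \<le> cnt S a v"
          using v0 by (auto intro: cnt_mono)
        then have "k \<le> 8 * cnt S a v"
          by (auto simp: j_def)
        then show "v \<in> R"
          using True v v0 by (auto simp: F_def)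
      qed
      moreover have "S \<inter> {v0..<p} \<inter> {p<..<q} = {}"
        by auto
      moreover have "S \<inter> {v0..<p} \<subseteq> {inner_lo P ls<..<inner_hi Q ls}"
      proof -
        have "inner_lo P ls < v0" "p < inner_hi Q ls"
          using geo v0 \<open>v0 \<noteq> a\<close> by linarith+
        then show ?thesis
          by auto
      qed
      moreover have "cnt S a p = j + card (S \<inter> {v0..<p})"
        using cnt_split[of a v0 p S] v0 by (simp add: cnt_def)
      then have "cnt S a p + cnt S q b \<le> card (S \<inter> {v0..<p}) + j + k div 4"
        using k(3) by simp
      ultimately show ?thesis
        by (rule that)
    next
      case False
      then have "G = {}"
        using \<open>\<not> (F \<noteq> {} \<and> G \<noteq> {})\<close> by blast
      have "j \<le> cnt S q b"
        using k by (auto simp: j_def)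
      then obtain v1 where v1: "v1 \<in> S" "q \<le> v1" "v1 \<le> b" "cnt S q v1 = cnt S q b - j"
        using item_of_rank[of q S b "cnt S q b - j"] geo by auto
      have v1b: "cnt S v1 b = j"
        using cnt_split[of q v1 b S] v1 \<open>j \<le> cnt S q b\<close> by simp
      have "card (S \<inter> {q..<v1}) = cnt S q b - j"
        using v1 by (simp add: cnt_def)
      then have "cnt S q b = card (S \<inter> {q..<v1}) + j"
        using \<open>j \<le> cnt S q b\<close> by simp
      then have dep: "cnt S a p + cnt S q b \<le> card (S \<inter> {q..<v1}) + j + k div 4"
        using k(2) by simp
      have "S \<inter> {q..<v1} \<subseteq> R"
      proof
        fix v assume v: "v \<in> S \<inter> {q..<v1}"
        then have "j \<le> cnt S v b"
          using v1b by (metis IntE atLeastLessThan_iff cnt_mono less_or_eq_imp_le order_refl)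
        then have "k \<le> 8 * cnt S v b"
          by (auto simp: j_def)
        then show "v \<in> R"
          using \<open>G = {}\<close> v v1 by (auto simp: G_def)
      qed
      moreover have "S \<inter> {q..<v1} \<inter> {p<..<q} = {}"
        using geo by auto
      moreover have "S \<inter> {q..<v1} \<subseteq> {inner_lo P ls<..<inner_hi Q ls}"
      proof -
        have "inner_lo P ls < q" "v1 \<le> inner_hi Q ls"
          using geo v1 by linarith+
        then show ?thesis
          by auto
      qed
      moreover note dep
      ultimately show ?thesis
        by (rule that)
    qed
    \<comment> \<open>By \<open>depT\<close> the bracket is at least \<open>k div 4 - j\<close>,
      about \<open>k / 8\<close>; asking only for \<open>k / 16\<close> leaves room for the
      rounding, as \<open>32 \<le> k\<close>.\<close>
    have pay: "real k \<le> 16 * (2 * real (k div 4) - real (cnt S a p) - real (cnt S q b) + card T)"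
    proof -
      define i where "i = k div 4"
      have "k < 4 + 4 * i" "j * 8 \<le> k + 7"
        unfolding i_def j_def by (rule dividend_less_times_div, simp) (rule div_times_less_eq_dividend)
      then have "k + 16 * j \<le> 16 * i"
        using k(1) by linarith
      then have "real (k + 16 * j) \<le> real (16 * i)"
        by (rule of_nat_mono)
      moreover have "real (cnt S a p + cnt S q b) \<le> real (card T + j + i)"
        using depT unfolding i_def by (rule of_nat_mono)
      ultimately show ?thesis
        unfolding i_def[symmetric] by simp
    qed
    obtain ls' where ls': "length ls' \<le> length ls" "chain_ok P Q (insert x S) M' ls'"
      "potential S ls + unsaturated ls
         \<le> potential (insert x S) ls' + 16 * \<kappa> * card (R - {inner_lo P ls<..<inner_hi Q ls})"
      using Cons.IH ch geo px by auto
    have "card T + card (R - {inner_lo P ls<..<inner_hi Q ls}) =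
        card (T \<union> (R - {inner_lo P ls<..<inner_hi Q ls}))"
      using T R finite_subset[OF T(1)] by (subst card_Un_disjoint) auto
    also have "\<dots> \<le> card (R - {p<..<q})"
      using T R geo by (intro card_mono) auto
    finally have "16 * \<kappa> * (real (card T) + card (R - {inner_lo P ls<..<inner_hi Q ls}))
        \<le> 16 * \<kappa> * card (R - {p<..<q})"
      using \<kappa>_pos by (intro mult_left_mono) auto
    moreover have "\<kappa> * k \<le>
        \<kappa> * (16 * (2 * real (k div 4) - real (cnt S a p) - real (cnt S q b) + card T))"
      using \<kappa>_pos by (intro mult_left_mono[OF pay]) auto
    moreover have "min e (\<kappa> * k) + ind \<le> \<kappa> * k"
      by (auto simp: ind_def)
    moreover have "unsaturated (l # ls) = ind + unsaturated ls"
      by (simp add: l ind_def)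
    ultimately have "potential S (l # ls) + unsaturated (l # ls)
      \<le> potential (insert x S) ls' + 16 * \<kappa> * card (R - {p<..<q})"
      using ls'(3) by (simp add: l algebra_simps)
    then show ?thesis
      using ls' by (intro exI[of _ ls']) (simp add: l)
  qed
qed

section \<open>Bounds on scores, saturation and potential\<close>

lemma score_le:
  assumes "strict_mono_on S M" "a \<in> S" "b \<in> S" "a < b"
  shows "score S M a b \<le> \<alpha> * ln (cnt S a b)"
proof -
  have "0 < cnt S a b" "cnt S a b + M a \<le> M b"
    using assms by (auto intro!: cnt_pos cnt_le_width)
  then have "ln (cnt S a b) \<le> ln (real (M b) - real (M a))"
    by (intro ln_mono) auto
  then show ?thesis
    by (simp add: score_def log_score_def algebra_simps)
qed

lemma unsaturated_le: "unsaturated ls \<le> length ls"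
  by (induction ls rule: unsaturated.induct) auto

text \<open>The links add up: every level costs \<open>6 * \<alpha>\<close>, and a saturated one has
  progress above \<open>\<kappa> * k - 1\<close>, hence at least half of
  \<open>\<kappa> * k\<close>, which gains \<open>\<kappa> / 20\<close>.\<close>

lemma outer_score_ge:
  "chain_ok P Q S M ls \<Longrightarrow>
    \<phi> - 6 * \<alpha> * length ls + \<kappa> / 20 * (real (length ls) - unsaturated ls) \<le> outer_score S M ls"
proof (induction ls)
  case (Cons l ls)
  obtain a p q b k e where l: "l = Level a p q b k e"
    by (cases l)
  have k: "kmin \<le> k" "0 < k"
    using Cons.prems kmin_ge by (auto simp: l)
  have "\<kappa> * kmin \<le> \<kappa> * k"
    using k \<kappa>_pos by (intro mult_left_mono) auto
  then have "2 \<le> \<kappa> * k"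
    using \<kappa>_kmin by linarith
  define ind where "ind = (if real e + 1 \<le> \<kappa> * k then 1 else 0 :: real)"
  have "\<kappa> * k / 2 * (1 - ind) \<le> min e (\<kappa> * k)"
    using \<open>2 \<le> \<kappa> * k\<close> by (auto simp: ind_def)
  then have "\<kappa> * k / 2 * (1 - ind) / (10 * real k) \<le> min e (\<kappa> * k) / (10 * real k)"
    by (intro divide_right_mono) auto
  then have "\<kappa> / 20 * (1 - ind) \<le> min e (\<kappa> * k) / (10 * real k)"
    using k by simp
  moreover have "outer_score S M ls - 6 * \<alpha> + min e (\<kappa> * k) / (10 * real k) \<le> score S M a b"
    using Cons.prems by (simp add: l)
  moreover have "\<phi> - 6 * \<alpha> * length ls + \<kappa> / 20 * (real (length ls) - unsaturated ls) \<le> outer_score S M ls"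
    using Cons by (simp add: l)
  ultimately have "\<phi> - 6 * \<alpha> * length ls - 6 * \<alpha> + \<kappa> / 20 * (real (length ls) - unsaturated ls)
      + \<kappa> / 20 * (1 - ind) \<le> score S M a b"
    by linarith
  moreover have "real (unsaturated (l # ls)) = ind + unsaturated ls"
    by (simp add: l ind_def)
  ultimately show ?case
    by (simp add: l algebra_simps add_divide_distrib diff_divide_distrib)
qed simp

lemma outer_cnt_le: "chain_ok P Q S M ls \<Longrightarrow> outer_cnt P Q S ls \<le> cnt S P Q"
proof (induction ls)
  case (Cons l ls)
  then show ?case
    by (cases l) auto
qed simp

text \<open>Saturated levels push up the score of the innermost outer segment, whose density is at
  most \<open>1\<close>. This limits their number.\<close>

lemma unsaturated_ge:
  assumes "chain_ok P Q S M ls" "strict_mono_on S M" "length ls = d" "0 < d"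
  shows "\<kappa> * (real d - unsaturated ls) \<le> 20 * (\<alpha> * ln (cnt S P Q) - \<phi> + 6 * \<alpha> * d)"
proof -
  obtain a p q b k e ls' where ls: "ls = Level a p q b k e # ls'"
    using assms by (cases ls rule: level_list_cases) auto
  have ab: "a \<in> S" "b \<in> S" "a < b"
    using assms(1) by (auto simp: ls)
  have "score S M a b \<le> \<alpha> * ln (cnt S a b)"
    using ab assms by (intro score_le)
  also have "\<dots> \<le> \<alpha> * ln (cnt S P Q)"
    using ab \<alpha>_pos cnt_pos[of a S b] outer_cnt_le[OF assms(1)]
    by (intro mult_left_mono ln_mono) (auto simp: ls)
  finally have "outer_score S M ls \<le> \<alpha> * ln (cnt S P Q)"
    by (simp add: ls)
  then have "\<phi> - 6 * \<alpha> * d + \<kappa> / 20 * (real d - unsaturated ls) \<le> \<alpha> * ln (cnt S P Q)"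
    using outer_score_ge[OF assms(1)] unfolding assms(3) by linarith
  then show ?thesis
    by simp
qed

text \<open>By \<open>linked\<close>, \<open>\<kappa> * k\<close> is at most
  \<open>2 * \<kappa>\<close> times the drop in the item count from one segment to the next, so the
  bounds telescope.\<close>

lemma potential_le:
  "chain_ok P Q S M ls \<Longrightarrow>
    potential S ls \<le> 2 * \<kappa> * (real (cnt S P Q) - outer_cnt P Q S ls)"
proof (induction ls)
  case (Cons l ls)
  obtain a p q b k e where l: "l = Level a p q b k e"
    by (cases l)
  have k: "cnt S a p \<le> k div 4" "cnt S q b \<le> k div 4" "2 * cnt S a b + k \<le> 2 * outer_cnt P Q S ls"
    using Cons.prems by (auto simp: l)
  have "0 \<le> 16 * \<kappa> * (2 * real (k div 4) - real (cnt S a p) - real (cnt S q b))"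
    using k \<kappa>_pos by (intro mult_nonneg_nonneg) auto
  moreover have "min e (\<kappa> * k) \<le> \<kappa> * k"
    by simp
  moreover have "real (2 * cnt S a b + k) \<le> real (2 * outer_cnt P Q S ls)"
    using k(3) by (rule of_nat_mono)
  then have "\<kappa> * k \<le> \<kappa> * (2 * real (outer_cnt P Q S ls) - 2 * real (cnt S a b))"
    using \<kappa>_pos by (intro mult_left_mono) auto
  moreover have "potential S ls \<le> 2 * \<kappa> * (real (cnt S P Q) - outer_cnt P Q S ls)"
    using Cons by (simp add: l)
  ultimately have "potential S (l # ls) \<le>
      \<kappa> * (2 * real (outer_cnt P Q S ls) - 2 * real (cnt S a b))
        + 2 * \<kappa> * (real (cnt S P Q) - outer_cnt P Q S ls)"
    unfolding l potential.simps by linarith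
  then show ?case
    by (simp add: l algebra_simps)
qed simp

text \<open>For a nonempty chain the last conjunct of \<open>level_ok\<close> supplies the score of
  the innermost segment; for an empty one it must be assumed. A new level has full margins and no
  progress, so the potential stays the same.\<close>

lemma extend_chain:
  assumes ch: "chain_ok P Q S M ls" and M: "strict_mono_on S M" and len: "length ls < d"
    and base: "ls = [] \<Longrightarrow> \<phi> \<le> score S M P Q \<and> 2 \<le> cnt S P Q"
  shows "\<exists>l. chain_ok P Q S M (l # ls) \<and> potential S (l # ls) = potential S ls"
proof -
  define P' where "P' = inner_lo P ls"
  define Q' where "Q' = inner_hi Q ls"
  define K where "K = cnt S P' Q'"
  have PQ: "P' \<in> S" "Q' \<in> S" "P' < Q'"
    using inner_in[OF ch] by (auto simp: P'_def Q'_def)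
  have K: "2 \<le> K" "K \<le> outer_cnt P Q S ls" and sc: "outer_score S M ls - 4 * \<alpha> \<le> score S M P' Q'"
  proof -
    have "2 \<le> K \<and> K \<le> outer_cnt P Q S ls \<and> outer_score S M ls - 4 * \<alpha> \<le> score S M P' Q'"
    proof (cases ls rule: level_list_cases)
      case 1
      then show ?thesis
        using base \<alpha>_pos by (auto simp: K_def P'_def Q'_def)
    next
      case (2 a p q b k e ls')
      have ok: "level_ok S M (Level a p q b k e)"
        using ch 2 by simp
      then have k: "32 \<le> k" "cnt S a p \<le> k div 4" "cnt S q b \<le> k div 4" "cnt S a b = k + e"
        "a \<le> p" "p < q" "q \<le> b"
        using kmin_ge by auto
      have sum: "cnt S a b = cnt S a p + cnt S p q + cnt S q b"
        using k cnt_split[of a p b S] cnt_split[of p q b S] by simp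
      have "2 \<le> cnt S p q"
      proof -
        define i where "i = k div 4"
        have "4 * i \<le> k"
          by (simp add: i_def)
        then show ?thesis
          using k sum unfolding i_def[symmetric] by linarith
      qed
      then show ?thesis
        using ok sum by (auto simp: K_def P'_def Q'_def 2)
    qed
    then show "2 \<le> K" "K \<le> outer_cnt P Q S ls" "outer_score S M ls - 4 * \<alpha> \<le> score S M P' Q'"
      by auto
  qed
  \<comment> \<open>The bound \<open>3 * k \<le> 2 * K\<close> is the gap
    \<open>2 * k + k \<le> 2 * K\<close> of \<open>linked\<close>, and it admits both halves of a
    bisection even for \<open>K = 3\<close>.\<close>
  define X where "X = {(a, b). a \<in> S \<and> b \<in> S \<and> P' \<le> a \<and> a < b \<and> b \<le> Q' \<and> 3 * cnt S a b \<le> 2 * K}"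
  have mono: "M a < M b" if "a \<in> S" "b \<in> S" "a < b" for a b
    using strict_mono_onD[OF M] that by auto
  have half: "\<exists>(a, b)\<in>X. score S M P' Q' - 2 * \<alpha> \<le> score S M a b"
  proof -
    obtain m where m: "m \<in> S" "P' \<le> m" "m \<le> Q'" "cnt S P' m = K div 2"
      using item_of_rank[of P' S Q' "K div 2"] PQ by (auto simp: K_def)
    have split: "K = cnt S P' m + cnt S m Q'"
      using m cnt_split[of P' m Q' S] by (simp add: K_def)
    have c: "0 < cnt S P' m" "0 < cnt S m Q'" "K \<le> 3 * cnt S P' m" "K \<le> 3 * cnt S m Q'"
      "3 * cnt S P' m \<le> 2 * K" "3 * cnt S m Q' \<le> 2 * K"
      using split m(4) K(1) by linarith+
    have "P' \<noteq> m" "m \<noteq> Q'"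
      using c by auto
    then have lt: "P' < m" "m < Q'"
      using m by auto
    have "log_score \<alpha> K (real (M Q') - real (M P')) - 2 * \<alpha> \<le> log_score \<alpha> (cnt S P' m) (real (M m) - real (M P')) \<or>
      log_score \<alpha> K (real (M Q') - real (M P')) - 2 * \<alpha> \<le> log_score \<alpha> (cnt S m Q') (real (M Q') - real (M m))"
    proof (rule log_score_half[OF \<alpha>_pos])
      show "real K = real (cnt S P' m) + real (cnt S m Q')"
        using split by simp
      show "real K \<le> 3 * real (cnt S P' m)" "real K \<le> 3 * real (cnt S m Q')"
        using c by linarith+
    qed (use mono[OF PQ(1) m(1) lt(1)] mono[OF m(1) PQ(2) lt(2)] K in auto)
    then have "score S M P' Q' - 2 * \<alpha> \<le> score S M P' m \<or> score S M P' Q' - 2 * \<alpha> \<le> score S M m Q'"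
      by (simp add: score_def K_def)
    moreover have "(P', m) \<in> X" "(m, Q') \<in> X"
      using PQ m lt c by (auto simp: X_def)
    ultimately show ?thesis
      by blast
  qed
  have "finite X"
    by (rule finite_subset[of _ "{..Q'} \<times> {..Q'}"]) (auto simp: X_def)
  moreover have "X \<noteq> {}"
    using half by auto
  ultimately have "Max ((\<lambda>(a, b). score S M a b) ` X) \<in> (\<lambda>(a, b). score S M a b) ` X"
    by (intro Max_in) auto
  then obtain a b where abX: "(a, b) \<in> X"
    and ab: "Max ((\<lambda>(a, b). score S M a b) ` X) = score S M a b"
    by auto
  have max: "score S M u v \<le> score S M a b" if "(u, v) \<in> X" for u v
    unfolding ab[symmetric] using that \<open>finite X\<close> by (intro Max_ge) force+
  define k where "k = cnt S a b"
  have a: "a \<in> S" "b \<in> S" "P' \<le> a" "a < b" "b \<le> Q'" "3 * k \<le> 2 * K"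
    using abX by (auto simp: X_def k_def)
  have score_ab: "outer_score S M ls - 6 * \<alpha> \<le> score S M a b"
    using half max sc by fastforce
  \<comment> \<open>The accumulated losses leave a score of at least
    \<open>\<alpha> * ln kmin\<close>, but distinct labels allow \<open>k\<close> items at most
    \<open>\<alpha> * ln k\<close>.\<close>
  have "kmin \<le> k"
  proof -
    have "\<alpha> * ln kmin \<le> \<phi> - 6 * \<alpha> * d"
      by (rule \<phi>_ge)
    also have "6 * \<alpha> * (length ls + 1) \<le> 6 * \<alpha> * d"
      using len \<alpha>_pos by (intro mult_left_mono) auto
    then have "\<phi> - 6 * \<alpha> * d \<le> \<phi> - 6 * \<alpha> * length ls - 6 * \<alpha>"
      by (simp add: algebra_simps)
    also have "0 \<le> \<kappa> / 20 * (real (length ls) - unsaturated ls)"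
      using \<kappa>_pos unsaturated_le[of ls] by simp
    then have "\<phi> - 6 * \<alpha> * length ls - 6 * \<alpha> \<le> score S M a b"
      using outer_score_ge[OF ch] score_ab by linarith
    also have "\<dots> \<le> \<alpha> * ln k"
      using a M unfolding k_def by (intro score_le)
    finally have "ln kmin \<le> ln k"
      using \<alpha>_pos by simp
    moreover have "0 < k"
      using a by (auto simp: k_def intro: cnt_pos)
    ultimately show ?thesis
      using kmin_ge by (subst (asm) ln_le_cancel_iff) auto
  qed
  then have k32: "32 \<le> k"
    using kmin_ge by simp
  define i where "i = k div 4"
  have i: "4 * i \<le> k" "k \<le> 8 * i"
  proof -
    have "k < 4 + 4 * i"
      unfolding i_def by (rule dividend_less_times_div) simp
    then show "k \<le> 8 * i"
      using k32 by linarith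
  qed (simp add: i_def)
  obtain p where p: "p \<in> S" "a \<le> p" "p \<le> b" "cnt S a p = i"
    using item_of_rank[of a S b i] a i by (auto simp: k_def)
  obtain q where q: "q \<in> S" "a \<le> q" "q \<le> b" "cnt S a q = k - i"
    using item_of_rank[of a S b "k - i"] a by (auto simp: k_def)
  have qb: "cnt S q b = i"
    using cnt_split[of a q b S] q i by (simp add: k_def)
  have pq: "p < q"
  proof (rule ccontr)
    assume "\<not> p < q"
    then have "cnt S a q \<le> cnt S a p"
      by (intro cnt_mono) auto
    then show False
      using p q i k32 by linarith
  qed
  \<comment> \<open>The margins cut off by \<open>p'\<close> and \<open>q'\<close> are themselves
    candidates in \<open>X\<close>, so maximality yields the hypotheses of
    \<open>log_score_middle\<close>.\<close>
  have good: "score S M a b - 4 * \<alpha> \<le> score S M p' q'"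
    if p': "p' \<in> S" "a \<le> p'" "p' \<le> p" "k \<le> 8 * cnt S a p'"
      and q': "q' \<in> S" "q \<le> q'" "q' \<le> b" "k \<le> 8 * cnt S q' b" for p' q'
  proof -
    have "p' \<noteq> a" "q' \<noteq> b"
      using p' q' k32 by auto
    then have lt: "a < p'" "p' < q'" "q' < b"
      using p' q' pq by auto
    have sum: "k = cnt S a p' + cnt S p' q' + cnt S q' b"
      using lt cnt_split[of a p' b S] cnt_split[of p' q' b S] by (simp add: k_def)
    have le: "cnt S a p' \<le> i" "cnt S q' b \<le> i"
      using p(4) qb p' q' cnt_mono[of a a p' p S] cnt_mono[of q q' b b S] by auto
    have "(a, p') \<in> X" "(q', b) \<in> X"
      using a p' q' lt sum by (auto simp: X_def)
    then have mx: "score S M a p' \<le> score S M a b" "score S M q' b \<le> score S M a b"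
      using max by auto
    have "log_score \<alpha> k (real (M b) - real (M a)) - 4 * \<alpha> \<le> log_score \<alpha> (cnt S p' q') (real (M q') - real (M p'))"
    proof (rule log_score_middle[OF \<alpha>_pos])
      show "real k = real (cnt S a p') + real (cnt S p' q') + real (cnt S q' b)"
        using sum by simp
      show "real k \<le> 8 * real (cnt S a p')" "real k \<le> 8 * real (cnt S q' b)"
        using p' q' by linarith+
      show "real k \<le> 2 * real (cnt S p' q')"
        using sum le i by linarith
      show "log_score \<alpha> (cnt S a p') (real (M p') - real (M a)) \<le> log_score \<alpha> k (real (M b) - real (M a))"
        "log_score \<alpha> (cnt S q' b) (real (M b) - real (M q')) \<le> log_score \<alpha> k (real (M b) - real (M a))"
        using mx by (simp_all add: score_def k_def)
    qed (use mono[OF a(1) p'(1) lt(1)] mono[OF p'(1) q'(1) lt(2)] mono[OF q'(1) a(2) lt(3)] k32 in auto)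
    then show ?thesis
      by (simp add: score_def k_def)
  qed
  have "level_ok S M (Level a p q b k 0)"
    using a p q pq qb i good \<open>kmin \<le> k\<close> by (simp add: i_def k_def)
  moreover have "linked P Q S M (Level a p q b k 0) ls"
    using a K score_ab \<kappa>_pos by (simp add: P'_def Q'_def k_def)
  moreover have "potential S (Level a p q b k 0 # ls) = potential S ls"
    using p qb \<kappa>_pos by (simp add: i_def)
  ultimately show ?thesis
    using ch by (intro exI[of _ "Level a p q b k 0"]) simp
qed

lemma extend_chain_to:
  assumes "chain_ok P Q S M ls" "strict_mono_on S M" "length ls \<le> d"
    and "ls = [] \<Longrightarrow> \<phi> \<le> score S M P Q \<and> 2 \<le> cnt S P Q"
  shows "\<exists>ls'. chain_ok P Q S M ls' \<and> length ls' = d \<and> potential S ls' = potential S ls"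
  using assms
proof (induction "d - length ls" arbitrary: ls)
  case 0
  then show ?case
    by auto
next
  case (Suc n)
  then have "length ls < d"
    by simp
  then obtain l where l: "chain_ok P Q S M (l # ls)" "potential S (l # ls) = potential S ls"
    using extend_chain[OF Suc.prems(1,2) _ Suc.prems(4)] by blast
  have "n = d - length (l # ls)" "length (l # ls) \<le> d"
    using Suc by auto
  then show ?case
    using Suc.hyps(1)[of "l # ls"] l Suc.prems by auto
qed

end

section \<open>Blocks\<close>

text \<open>
  The first \<open>n - g * B\<close> items are the multiples of \<open>2 ^ n\<close>. They form \<open>B\<close> blocks of \<open>g\<close> items and
  a tail, and every block later receives exactly \<open>g\<close> further items. After \<open>t\<close> insertions all items
  are multiples of \<open>2 ^ (n - t)\<close>, so that there is room for a new item right after any item.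
\<close>

locale blocks =
  fixes n g B :: nat
  assumes g_pos: "0 < g" and n_gt: "2 * g * B < n" and n_le: "n \<le> 2 * g * B + 2 * g"
begin

definition N0 :: nat where "N0 = n - g * B"

definition border :: "nat \<Rightarrow> nat" where "border b = b * g * 2 ^ n"

definition block_cnt :: "nat list \<Rightarrow> nat \<Rightarrow> nat" where
  "block_cnt us b = cnt (set us) (border b) (border (Suc b))"

text \<open>The final rank of the first item in the block of \<open>u\<close>; the minimum treats
  the tail as block \<open>B\<close>.\<close>

definition predicted :: "nat \<Rightarrow> nat" where
  "predicted u = 2 * g * min (u div (g * 2 ^ n)) B"

text \<open>The tail never grows. It is nonempty, so that \<open>border B\<close> is stored and the
  last block also has an item at its right end.\<close>

definition base :: "nat list \<Rightarrow> bool" where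
  "base us \<longleftrightarrow> N0 \<le> length us \<and> length us \<le> n \<and> distinct us \<and>
     (\<forall>u\<in>set us. 2 ^ (n - length us) dvd u \<and> u < N0 * 2 ^ n) \<and>
     (\<forall>b\<le>B. border b \<in> set us) \<and>
     (\<forall>b<B. g \<le> block_cnt us b \<and> block_cnt us b \<le> 2 * g) \<and>
     cnt (set us) (border B) (N0 * 2 ^ n) = N0 - g * B"

lemma N0_gt: "g * B < N0"
  using n_gt by (simp add: N0_def)

lemma N0_le: "N0 \<le> n"
  by (simp add: N0_def)

lemma border_mono: "b \<le> c \<Longrightarrow> border b \<le> border c"
  by (simp add: border_def)

lemma border_less: "b < c \<Longrightarrow> border b < border c"
  using g_pos by (simp add: border_def)

lemma border_le_N0: "border B < N0 * 2 ^ n"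
  using N0_gt by (simp add: border_def mult.commute)

lemma cnt_initial:
  assumes "i \<le> j" "j \<le> N0"
  shows "cnt (set (map (\<lambda>j. j * 2 ^ n) [0..<N0])) (i * 2 ^ n) (j * 2 ^ n) = j - i"
proof -
  have "set (map (\<lambda>j. j * 2 ^ n) [0..<N0]) \<inter> {i * 2 ^ n..<j * 2 ^ n} = (\<lambda>j. j * 2 ^ n) ` {i..<j}"
    using assms by auto
  moreover have "inj_on (\<lambda>j. j * 2 ^ n :: nat) {i..<j}"
    by (auto simp: inj_on_def)
  ultimately show ?thesis
    by (simp add: cnt_def card_image)
qed

lemma base_initial: "base (map (\<lambda>j. j * 2 ^ n) [0..<N0])"
proof -
  have le: "b * g \<le> g * B" if "b \<le> B" for b
    using that by (simp add: mult.commute)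
  have "border b \<in> set (map (\<lambda>j. j * 2 ^ n) [0..<N0])" if "b \<le> B" for b
  proof -
    have "b * g < N0"
      using le[OF that] N0_gt by (rule le_less_trans)
    then show ?thesis
      by (auto simp: border_def)
  qed
  moreover have "block_cnt (map (\<lambda>j. j * 2 ^ n) [0..<N0]) b = g" if "b < B" for b
    using cnt_initial[of "b * g" "Suc b * g"] le[of "Suc b"] N0_gt that
    unfolding block_cnt_def border_def by simp
  moreover have "cnt (set (map (\<lambda>j. j * 2 ^ n) [0..<N0])) (border B) (N0 * 2 ^ n) = N0 - g * B"
    using cnt_initial[of "B * g" N0] N0_gt unfolding border_def by (simp add: mult.commute)
  moreover have "distinct (map (\<lambda>j. j * 2 ^ n :: nat) [0..<N0])"
    by (auto simp: distinct_map inj_on_def)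
  moreover have "2 ^ (n - N0) dvd j * (2::nat) ^ n" for j
    by (intro dvd_mult le_imp_power_dvd) simp
  ultimately show ?thesis
    using N0_le unfolding base_def by auto
qed

lemma cnt_border:
  "cnt S 0 (border b) = (\<Sum>c<b. cnt S (border c) (border (Suc c)))"
proof (induction b)
  case 0
  then show ?case
    by (simp add: border_def)
next
  case (Suc b)
  then show ?case
    using cnt_split[of 0 "border b" "border (Suc b)" S] border_mono[of b "Suc b"] by simp
qed

lemma base_sum:
  assumes "base us"
  shows "(\<Sum>b<B. block_cnt us b) + N0 = length us + g * B"
proof -
  have "set us \<inter> {0..<N0 * 2 ^ n} = set us"
    using assms by (auto simp: base_def)
  then have "cnt (set us) 0 (N0 * 2 ^ n) = length us"
    using assms by (simp add: cnt_def base_def distinct_card)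
  then have "length us = cnt (set us) 0 (border B) + (N0 - g * B)"
    using cnt_split[of 0 "border B" "N0 * 2 ^ n" "set us"] border_le_N0 assms
    by (simp add: base_def)
  then show ?thesis
    using N0_gt by (simp add: cnt_border block_cnt_def)
qed

text \<open>The new item lies half a grid step after \<open>p\<close>, hence off the old grid and
  before the next item.\<close>

lemma base_snoc:
  assumes base: "base us" and len: "length us < n" and p: "p \<in> set us"
    and b: "b < B" "border b \<le> p" "p < border (Suc b)" "block_cnt us b < 2 * g"
  defines "x \<equiv> p + 2 ^ (n - Suc (length us))"
  shows "x \<notin> set us" "p < x" "x < N0 * 2 ^ n" "\<And>q. q \<in> set us \<Longrightarrow> p < q \<Longrightarrow> x < q"
    "base (us @ [x])" "block_cnt (us @ [x]) b = Suc (block_cnt us b)"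
    "\<And>c. c \<noteq> b \<Longrightarrow> block_cnt (us @ [x]) c = block_cnt us c"
proof -
  define h :: nat where "h = 2 ^ (n - Suc (length us))"
  have h: "2 ^ (n - length us) = 2 * h" "0 < h"
    using len by (auto simp: h_def Suc_diff_Suc simp flip: power_Suc)
  have x: "x = p + h"
    by (simp add: x_def h_def)
  have grid: "2 * h dvd u" "u < N0 * 2 ^ n" if "u \<in> set us" for u
    using base that h by (auto simp: base_def)
  show xS: "x \<notin> set us"
  proof
    assume "x \<in> set us"
    then have "2 * h dvd (p + h) - p"
      using grid[of x] grid[OF p] x by (intro dvd_diff_nat) auto
    then show False
      using h by auto
  qed
  show "p < x"
    using h x by simp
  show less: "x < q" if "q \<in> set us" "p < q" for q
  proof -
    have "2 * h dvd q - p"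
      using grid[OF that(1)] grid[OF p] by (intro dvd_diff_nat) auto
    then have "2 * h \<le> q - p"
      using that by (intro dvd_imp_le) auto
    then show ?thesis
      using that x h by linarith
  qed
  have xb: "border b \<le> x" "x < border (Suc b)"
    using less[of "border (Suc b)"] b x base by (auto simp: base_def)
  have "border (Suc b) \<le> border B"
    using b by (intro border_mono) simp
  then have xB: "x < border B"
    using xb by simp
  then show xN: "x < N0 * 2 ^ n"
    using border_le_N0 by simp
  show bb: "block_cnt (us @ [x]) b = Suc (block_cnt us b)"
    using xb xS by (simp add: block_cnt_def cnt_insert)
  show bc: "block_cnt (us @ [x]) c = block_cnt us c" if "c \<noteq> b" for c
  proof -
    have "\<not> (border c \<le> x \<and> x < border (Suc c))"
    proof (cases "c < b")
      case True
      then show ?thesis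
        using xb border_mono[of "Suc c" b] by simp
    next
      case False
      then show ?thesis
        using xb border_mono[of "Suc b" c] that by simp
    qed
    then show ?thesis
      using xS by (simp add: block_cnt_def cnt_insert)
  qed
  have dvd: "h dvd u" if "u \<in> set (us @ [x])" for u
    using that grid dvd_mult_right[of 2 h] grid[OF p] x by (auto intro: dvd_add)
  have "\<forall>c<B. g \<le> block_cnt (us @ [x]) c \<and> block_cnt (us @ [x]) c \<le> 2 * g"
  proof (intro allI impI)
    fix c assume "c < B"
    then show "g \<le> block_cnt (us @ [x]) c \<and> block_cnt (us @ [x]) c \<le> 2 * g"
      using base b bb bc[of c] by (cases "c = b") (auto simp: base_def)
  qed
  moreover have "cnt (set (us @ [x])) (border B) (N0 * 2 ^ n) = N0 - g * B"
    using xB xS base by (simp add: cnt_insert base_def)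
  moreover have "\<forall>u\<in>set (us @ [x]). 2 ^ (n - length (us @ [x])) dvd u \<and> u < N0 * 2 ^ n"
    using dvd grid(2) xN by (auto simp: h_def)
  ultimately show "base (us @ [x])"
    using base len xS unfolding base_def by auto
qed

lemma base_unfilled:
  assumes "base us" "length us < n"
  shows "\<exists>b<B. block_cnt us b < 2 * g"
proof (rule ccontr)
  assume "\<not> ?thesis"
  then have "(\<Sum>b<B. 2 * g) \<le> (\<Sum>b<B. block_cnt us b)"
    by (intro sum_mono) (simp add: leI)
  then show False
    using base_sum[OF assms(1)] assms(2) n_gt by (simp add: N0_def algebra_simps)
qed

text \<open>The block sizes sum to \<open>2 * g * B\<close> and none exceeds \<open>2 * g\<close>,
  so all blocks are full. Hence exactly \<open>predicted u\<close> items precede the block of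
  \<open>u\<close>, and at most \<open>2 * g\<close> lie between its border and
  \<open>u\<close>.\<close>

lemma base_complete:
  assumes base: "base us" and len: "length us = n" and u: "u \<in> set us"
  shows "nat \<bar>int (predicted u) - int (card {v \<in> set us. v < u})\<bar> \<le> 2 * g"
proof -
  define b where "b = min (u div (g * 2 ^ n)) B"
  have "(\<Sum>b<B. block_cnt us b) = (\<Sum>b<B. 2 * g)"
    using base_sum[OF base] len n_gt by (simp add: N0_def algebra_simps)
  moreover have "block_cnt us b \<le> 2 * g" if "b < B" for b
    using base that by (simp add: base_def)
  ultimately have full: "block_cnt us b = 2 * g" if "b < B" for b
    using sum_mono_inv[of "block_cnt us" "{..<B}" "\<lambda>_. 2 * g" b] that by auto
  have "b \<le> B"
    by (simp add: b_def)
  then have "cnt (set us) 0 (border b) = (\<Sum>c<b. 2 * g)"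
    unfolding cnt_border using full by (intro sum.cong) (auto simp: block_cnt_def)
  then have left: "cnt (set us) 0 (border b) = predicted u"
    by (simp add: predicted_def b_def)
  have "b * (g * 2 ^ n) \<le> u div (g * 2 ^ n) * (g * 2 ^ n)"
    unfolding b_def by (intro mult_right_mono) auto
  also have "\<dots> \<le> u"
    by (rule div_times_less_eq_dividend)
  finally have bu: "border b \<le> u"
    by (simp add: border_def mult.assoc)
  have right: "cnt (set us) (border b) u \<le> 2 * g"
  proof (cases "b < B")
    case True
    then have "b = u div (g * 2 ^ n)"
      by (simp add: b_def min_def split: if_splits)
    then have "u < g * 2 ^ n + g * 2 ^ n * b"
      using g_pos by (simp add: dividend_less_times_div)
    then have "u \<le> border (Suc b)"
      by (simp add: border_def algebra_simps)
    then have "cnt (set us) (border b) u \<le> block_cnt us b"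
      unfolding block_cnt_def by (intro cnt_mono) auto
    then show ?thesis
      using full[OF True] by simp
  next
    case False
    then have "b = B"
      using \<open>b \<le> B\<close> by simp
    moreover have "u \<le> N0 * 2 ^ n"
      using base u by (auto simp: base_def intro: less_imp_le)
    ultimately have "cnt (set us) (border b) u \<le> cnt (set us) (border B) (N0 * 2 ^ n)"
      by (intro cnt_mono) auto
    then show ?thesis
      using base n_le by (simp add: base_def N0_def)
  qed
  have "card {v \<in> set us. v < u} = cnt (set us) 0 u"
    unfolding cnt_def by (intro arg_cong[where f = card]) auto
  also have "\<dots> = predicted u + cnt (set us) (border b) u"
    using cnt_split[of 0 "border b" u "set us"] bu left by simp
  finally show ?thesis
    using right by simp
qed

text \<open>After at most half of the \<open>g * B\<close> late insertions, at most half of the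
  blocks are full. The others are disjoint and share \<open>m\<close> slots, so one of them has at
  most \<open>2 * m / B\<close>.\<close>

lemma base_narrow_block:
  assumes base: "base us" and M: "number_labeling m (set us) M"
    and few: "2 * (length us - N0) \<le> g * B" and B: "0 < B"
  shows "\<exists>b<B. block_cnt us b < 2 * g \<and> (M (border (Suc b)) - M (border b)) * B \<le> 2 * m"
proof (rule ccontr)
  assume neg: "\<not> ?thesis"
  define F where "F = {b \<in> {..<B}. block_cnt us b = 2 * g}"
  define U where "U = {..<B} - F"
  define w where "w b = M (border (Suc b)) - M (border b)" for b
  have F: "F \<subseteq> {..<B}" "finite F"
    by (auto simp: F_def)
  have "(\<Sum>b<B. g + (if b \<in> F then g else 0)) \<le> (\<Sum>b<B. block_cnt us b)"
    using base by (intro sum_mono) (auto simp: F_def base_def)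
  also have "(\<Sum>b<B. g + (if b \<in> F then g else 0)) = g * B + g * card F"
    using F by (simp add: sum.distrib sum.If_cases Int_absorb1)
  finally have "g * (2 * card F) \<le> g * B"
    using base_sum[OF base] few by linarith
  then have "2 * card F \<le> B"
    using g_pos by simp
  then have U: "B \<le> 2 * card U"
    using F by (simp add: U_def card_Diff_subset)
  have bS: "border b \<in> set us" if "b \<le> B" for b
    using base that by (simp add: base_def)
  have smM: "strict_mono_on (set us) M"
    using M by (simp add: number_labeling_def)
  have mono: "M (border b) \<le> M (border c)" if "b \<le> c" "c \<le> B" for b c
    using that bS border_mono[of b c] by (intro strict_mono_on_leD[OF smM]) auto
  have tel: "M (border 0) + (\<Sum>b<c. w b) = M (border c)" if "c \<le> B" for c
    using that
  proof (induction c)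
    case (Suc c)
    then show ?case
      using mono[of c "Suc c"] by (simp add: w_def)
  qed simp
  have "M (border B) < m"
    using M bS[of B] by (auto simp: number_labeling_def)
  then have "(\<Sum>b<B. w b) \<le> m"
    using tel[of B] by simp
  moreover have "(\<Sum>b\<in>U. w b) \<le> (\<Sum>b<B. w b)"
    by (intro sum_mono2) (auto simp: U_def)
  ultimately have up: "(\<Sum>b\<in>U. w b) * (2 * B) \<le> m * (2 * B)"
    by (intro mult_right_mono) auto
  have "2 * m + 1 \<le> w b * B" if "b \<in> U" for b
  proof -
    have "b < B" "block_cnt us b \<noteq> 2 * g"
      using that by (auto simp: U_def F_def)
    moreover have "block_cnt us b \<le> 2 * g"
      using base calculation by (simp add: base_def)
    ultimately have "\<not> w b * B \<le> 2 * m"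
      using neg by (auto simp: w_def)
    then show ?thesis
      by simp
  qed
  then have "(\<Sum>b\<in>U. 2 * m + 1) \<le> (\<Sum>b\<in>U. w b * B)"
    by (intro sum_mono)
  then have "card U * (2 * m + 1) \<le> (\<Sum>b\<in>U. w b) * B"
    by (simp add: sum_distrib_right)
  then have "2 * card U * (2 * m + 1) \<le> (\<Sum>b\<in>U. w b) * (2 * B)"
    by simp
  moreover have "B * (2 * m + 1) \<le> 2 * card U * (2 * m + 1)"
    using U by (intro mult_right_mono) auto
  ultimately have "B * (2 * m + 1) \<le> m * (2 * B)"
    using up by linarith
  then show False
    using B by (simp add: algebra_simps)
qed

end

section \<open>The adversary\<close>

text \<open>During the first \<open>Q\<close> late insertions a narrow unfilled block always exists.
  \<open>base_score\<close> concerns \<open>g\<close> items in such a block, and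
  \<open>growth\<close> keeps at most half of the levels saturated in a block of up to
  \<open>2 * g\<close> items.\<close>

locale block_adversary = segment_chains \<alpha> \<kappa> \<phi> kmin d + blocks n g B
  for \<alpha> \<kappa> \<phi> :: real and kmin d n g B :: nat +
  fixes m Q :: nat
  assumes d_pos: "0 < d" and g_ge: "2 \<le> g" and B_pos: "0 < B"
    and Q_le: "2 * Q \<le> g * B"
    and base_score: "\<phi> \<le> log_score \<alpha> g (2 * real m / B)"
    and growth: "20 * (\<alpha> * ln (2 * real g) - \<phi> + 6 * \<alpha> * d) \<le> \<kappa> * d / 2"
begin

definition full :: "nat list \<Rightarrow> nat set" where
  "full us = {b \<in> {..<B}. block_cnt us b = 2 * g}"

text \<open>
  \<open>M\<close> is the lazy labeling, \<open>z\<close> its cost so far. The last term of the invariant makes up for the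
  chains given up when their block became full.
\<close>

definition running :: "nat list \<Rightarrow> (nat \<Rightarrow> nat) \<Rightarrow> nat \<Rightarrow> bool" where
  "running us lab y \<longleftrightarrow> base us \<and> number_labeling m (set us) lab \<and>
     (\<exists>M z b ls. number_labeling m (set us) M \<and> z + card {v \<in> set us. M v \<noteq> lab v} \<le> y \<and>
        b < B \<and> block_cnt us b < 2 * g \<and>
        chain_ok (border b) (border (Suc b)) (set us) M ls \<and> length ls = d \<and>
        real (length us - N0) * (d / 2)
          \<le> potential (set us) ls + 16 * \<kappa> * z + 4 * g * \<kappa> * card (full us))"

text \<open>This remains of \<open>running\<close> after \<open>Q\<close> late insertions: the
  current chain and each of at most \<open>B\<close> full blocks contribute at most
  \<open>4 * g * \<kappa>\<close>.\<close>

definition finished :: "nat list \<Rightarrow> nat \<Rightarrow> bool" where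
  "finished us y \<longleftrightarrow> base us \<and> Q * (d / 2) \<le> 16 * \<kappa> * y + 4 * g * \<kappa> * (B + 1)"

lemma start_chain:
  assumes base: "base us" and M: "number_labeling m (set us) M" and few: "length us - N0 \<le> Q"
  shows "\<exists>b ls. b < B \<and> block_cnt us b < 2 * g \<and>
    chain_ok (border b) (border (Suc b)) (set us) M ls \<and> length ls = d \<and> potential (set us) ls = 0"
proof -
  obtain b where b: "b < B" "block_cnt us b < 2 * g"
    "(M (border (Suc b)) - M (border b)) * B \<le> 2 * m"
    using base_narrow_block[OF base M _ B_pos] few Q_le by auto
  have smM: "strict_mono_on (set us) M"
    using M by (simp add: number_labeling_def)
  have bS: "border b \<in> set us" "border (Suc b) \<in> set us"
    using base b by (auto simp: base_def)
  have lt: "M (border b) < M (border (Suc b))"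
    using bS border_less[of b "Suc b"] by (intro strict_mono_onD[OF smM]) auto
  define w where "w = M (border (Suc b)) - M (border b)"
  have "real (w * B) \<le> real (2 * m)"
    using b(3) unfolding w_def by (rule of_nat_mono)
  then have "real w \<le> 2 * real m / B"
    using B_pos by (simp add: field_simps)
  then have "ln w \<le> ln (2 * real m / B)"
    using lt by (intro ln_mono) (auto simp: w_def)
  moreover have g: "g \<le> cnt (set us) (border b) (border (Suc b))"
    using base b by (simp add: base_def block_cnt_def)
  then have "(1 + \<alpha>) * ln g \<le> (1 + \<alpha>) * ln (cnt (set us) (border b) (border (Suc b)))"
    using g_pos \<alpha>_pos by (intro mult_left_mono ln_mono) auto
  ultimately have "\<phi> \<le> score (set us) M (border b) (border (Suc b))"
    using base_score lt by (simp add: score_def log_score_def w_def of_nat_diff)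
  then have "\<exists>ls'. chain_ok (border b) (border (Suc b)) (set us) M ls' \<and> length ls' = d \<and>
      potential (set us) ls' = potential (set us) []"
    using bS border_less[of b "Suc b"] smM g g_ge by (intro extend_chain_to) auto
  then show ?thesis
    using b by auto
qed

lemma running_initial:
  assumes "number_labeling m (set (map (\<lambda>j. j * 2 ^ n) [0..<N0])) lab"
  shows "running (map (\<lambda>j. j * 2 ^ n) [0..<N0]) lab y"
proof -
  define us where "us = map (\<lambda>j. j * 2 ^ n) [0..<N0]"
  have us: "base us" "number_labeling m (set us) lab" "length us = N0"
    using assms base_initial by (auto simp: us_def)
  obtain b ls where b: "b < B" "block_cnt us b < 2 * g"
    "chain_ok (border b) (border (Suc b)) (set us) lab ls" "length ls = d" "potential (set us) ls = 0"
    using start_chain[OF us(1,2)] us(3) by auto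
  have "running us lab y"
    unfolding running_def using us b \<kappa>_pos
    by (intro conjI exI[of _ lab] exI[of _ 0] exI[of _ b] exI[of _ ls]) auto
  then show ?thesis
    by (simp add: us_def)
qed

lemma running_step:
  assumes run: "running us lab y" and len: "length us - N0 < Q" "length us < n"
  shows "\<exists>u<N0 * 2 ^ n. u \<notin> set us \<and> (\<forall>lab'. number_labeling m (set (us @ [u])) lab' \<longrightarrow>
    running (us @ [u]) lab' (y + 1 + card {v \<in> set us. lab' v \<noteq> lab v}))"
proof -
  obtain M z b ls where base: "base us" and lab: "number_labeling m (set us) lab"
    and M: "number_labeling m (set us) M" and z: "z + card {v \<in> set us. M v \<noteq> lab v} \<le> y"
    and b: "b < B" "block_cnt us b < 2 * g"
    and ch: "chain_ok (border b) (border (Suc b)) (set us) M ls" "length ls = d"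
    and pot: "real (length us - N0) * (d / 2)
      \<le> potential (set us) ls + 16 * \<kappa> * z + 4 * g * \<kappa> * card (full us)"
    using run unfolding running_def by blast
  define P where "P = border b"
  define P' where "P' = border (Suc b)"
  define p where "p = inner_lo P ls"
  define q where "q = inner_hi P' ls"
  have pq: "p \<in> set us" "q \<in> set us" "p < q"
    using inner_in[OF ch(1)] by (auto simp: p_def q_def P_def P'_def)
  have within: "P \<le> inner_lo P ls \<and> inner_hi P' ls \<le> P'"
    if "chain_ok P P' S N ls" for S N ls
    using that
  proof (induction ls)
    case (Cons l ls)
    then show ?case
      by (cases l) auto
  qed simp
  have pP: "border b \<le> p" "q \<le> border (Suc b)"
    using within ch(1) by (auto simp: p_def q_def P_def P'_def)
  define x where "x = p + 2 ^ (n - Suc (length us))"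
  have "p < border (Suc b)"
    using pP pq by simp
  note snoc = base_snoc[OF base len(2) pq(1) b(1) pP(1) this b(2), folded x_def]
  have xpq: "p < x" "x < q"
    using snoc(2) snoc(4)[OF pq(2,3)] by auto
  \<comment> \<open>At most half of the levels are saturated, so the insertion gains at least
    \<open>d / 2\<close>.\<close>
  have unsat: "real d / 2 \<le> unsaturated ls"
  proof -
    have "0 < cnt (set us) P P'" "cnt (set us) P P' \<le> 2 * g"
      using b(2) base b(1) g_pos by (auto simp: block_cnt_def P_def P'_def base_def)
    then have "ln (cnt (set us) P P') \<le> ln (2 * real g)"
      by (intro ln_mono) auto
    then have "\<alpha> * ln (cnt (set us) P P') \<le> \<alpha> * ln (2 * real g)"
      using \<alpha>_pos by (intro mult_left_mono) auto
    moreover have "\<kappa> * (real d - unsaturated ls) \<le> 20 * (\<alpha> * ln (cnt (set us) P P') - \<phi> + 6 * \<alpha> * d)"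
      using ch M d_pos by (intro unsaturated_ge[where M = M]) (auto simp: P_def P'_def number_labeling_def)
    ultimately have "\<kappa> * (real d - unsaturated ls) \<le> \<kappa> * (d / 2)"
      using growth by simp
    then show ?thesis
      using \<kappa>_pos by simp
  qed
  show ?thesis
  proof (intro exI[of _ x] conjI allI impI)
    show "x < N0 * 2 ^ n" "x \<notin> set us"
      using snoc by auto
    fix lab' assume lab': "number_labeling m (set (us @ [x])) lab'"
    define us' where "us' = us @ [x]"
    have set': "set us' = insert x (set us)"
      by (simp add: us'_def)
    have base': "base us'"
      using snoc by (simp add: us'_def)
    obtain R where R: "x \<in> R" "R \<subseteq> insert x (set us)"
      "\<And>v w. v \<in> R \<Longrightarrow> w \<in> set us \<Longrightarrow> v \<le> w \<and> w \<le> x \<or> x \<le> w \<and> w \<le> v \<Longrightarrow> w \<in> R"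
      "number_labeling m (insert x (set us)) (\<lambda>v. if v \<in> R then lab' v else M v)"
      "card R + card {v \<in> insert x (set us). (if v \<in> R then lab' v else M v) \<noteq> lab' v}
         \<le> 1 + card {v \<in> set us. M v \<noteq> lab v} + card {v \<in> set us. lab' v \<noteq> lab v}"
      using lazy_labeling_step[OF _ snoc(1) M, of lab' lab] lab' by auto
    define M' where "M' = (\<lambda>v. if v \<in> R then lab' v else M v)"
    define z' where "z' = z + card R"
    define y' where "y' = y + 1 + card {v \<in> set us. lab' v \<noteq> lab v}"
    have M': "number_labeling m (set us') M'"
      using R(4) by (simp add: M'_def set')
    have z': "z' + card {v \<in> set us'. M' v \<noteq> lab' v} \<le> y'"
      using R(5) z by (simp add: M'_def z'_def y'_def set')
    have finR: "finite R"
      using R(2) finite_subset by blast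
    obtain ls1 where ls1: "length ls1 \<le> length ls" "chain_ok P P' (insert x (set us)) M' ls1"
      "potential (set us) ls + unsaturated ls
        \<le> potential (insert x (set us)) ls1 + 16 * \<kappa> * card (R - {inner_lo P ls<..<inner_hi P' ls})"
      using repair_chain[of P P' "set us" M ls x R M'] ch(1) snoc(1) xpq finR R(1-3)
      by (auto simp: M'_def P_def P'_def p_def q_def)
    have "card (R - {inner_lo P ls<..<inner_hi P' ls}) \<le> card R"
      using finR by (intro card_mono) auto
    then have "16 * \<kappa> * card (R - {inner_lo P ls<..<inner_hi P' ls}) \<le> 16 * \<kappa> * card R"
      using \<kappa>_pos by (intro mult_left_mono) auto
    then have pot1: "potential (set us) ls + d / 2 \<le> potential (set us') ls1 + 16 * \<kappa> * card R"
      using ls1(3) unsat by (simp add: set')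
    have fin_full: "finite (full us)" for us
      by (simp add: full_def)
    have full_sub: "full us \<subseteq> full us'"
    proof
      fix c assume "c \<in> full us"
      then show "c \<in> full us'"
        using snoc(7)[of c] b(2) by (cases "c = b") (auto simp: full_def us'_def)
    qed
    have full_mono: "4 * g * \<kappa> * card (full us) \<le> 4 * g * \<kappa> * card (full us')"
      using \<kappa>_pos card_mono[OF fin_full full_sub] by (intro mult_left_mono) auto
    have "\<exists>b' ls'. b' < B \<and> block_cnt us' b' < 2 * g \<and>
        chain_ok (border b') (border (Suc b')) (set us') M' ls' \<and> length ls' = d \<and>
        potential (set us') ls1 + 4 * g * \<kappa> * card (full us)
          \<le> potential (set us') ls' + 4 * g * \<kappa> * card (full us')"
    \<comment> \<open>A shortened chain is refilled in its block, unless it is empty, when the score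
      of the block may have dropped below \<phi>, or the block is full. Then a chain starts afresh
      in a narrow block.\<close>
    proof (cases "ls1 \<noteq> [] \<and> block_cnt us' b < 2 * g")
      case True
      have "\<exists>ls'. chain_ok P P' (set us') M' ls' \<and> length ls' = d \<and>
          potential (set us') ls' = potential (set us') ls1"
        using True ls1 ch M' by (intro extend_chain_to) (auto simp: set' number_labeling_def)
      then obtain ls' where "chain_ok P P' (set us') M' ls'" "length ls' = d"
          "potential (set us') ls' = potential (set us') ls1"
        by blast
      then show ?thesis
        using full_mono True b(1) unfolding P_def P'_def by (intro exI[of _ b] exI[of _ ls']) simp
    next
      case False
      have "length us' - N0 \<le> Q"
        using len by (simp add: us'_def)
      then obtain b' ls' where ls': "b' < B" "block_cnt us' b' < 2 * g"
        "chain_ok (border b') (border (Suc b')) (set us') M' ls'" "length ls' = d"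
        "potential (set us') ls' = 0"
        using start_chain[OF base' M'] by blast
      have "potential (set us') ls1 + 4 * g * \<kappa> * card (full us) \<le> 4 * g * \<kappa> * card (full us')"
      proof (cases "ls1 = []")
        case True
        then show ?thesis
          using full_mono by simp
      next
        case False
        \<comment> \<open>The abandoned chain has potential at most \<open>4 * g * \<kappa>\<close>,
          the credit that the newly full block adds.\<close>
        then have bf: "block_cnt us' b = 2 * g"
          using \<open>\<not> (ls1 \<noteq> [] \<and> block_cnt us' b < 2 * g)\<close> base' b(1) by (auto simp: base_def)
        have "potential (set us') ls1 \<le> 2 * \<kappa> * (real (cnt (set us') P P') - outer_cnt P P' (set us') ls1)"
          using ls1(2) by (intro potential_le) (simp add: set')
        also have "\<dots> \<le> 2 * \<kappa> * (2 * g)"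
          using \<kappa>_pos bf by (intro mult_left_mono) (auto simp: block_cnt_def P_def P'_def)
        finally have p1: "potential (set us') ls1 \<le> 4 * g * \<kappa>"
          by (simp add: algebra_simps)
        have "insert b (full us) \<subseteq> full us'"
          using full_sub bf b(1) by (auto simp: full_def)
        then have "card (insert b (full us)) \<le> card (full us')"
          using fin_full by (intro card_mono) auto
        moreover have "b \<notin> full us"
          using b(2) by (simp add: full_def)
        ultimately have "card (full us) + 1 \<le> card (full us')"
          using fin_full by simp
        then have "4 * g * \<kappa> * (real (card (full us)) + 1) \<le> 4 * g * \<kappa> * card (full us')"
          using \<kappa>_pos by (intro mult_left_mono) auto
        then show ?thesis
          using p1 by (simp add: algebra_simps)
      qed
      then show ?thesis
        using ls' by (intro exI[of _ b'] exI[of _ ls']) simp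
    qed
    then obtain b' ls' where ls': "b' < B" "block_cnt us' b' < 2 * g"
        "chain_ok (border b') (border (Suc b')) (set us') M' ls'" "length ls' = d"
        "potential (set us') ls1 + 4 * g * \<kappa> * card (full us)
          \<le> potential (set us') ls' + 4 * g * \<kappa> * card (full us')"
      by blast
    have "real (length us' - N0) = real (length us - N0) + 1"
      using base by (auto simp: us'_def base_def Suc_diff_le)
    then have "real (length us' - N0) * (d / 2) = real (length us - N0) * (d / 2) + d / 2"
      by (simp add: algebra_simps)
    also have "\<dots> \<le> potential (set us') ls' + 16 * \<kappa> * z' + 4 * g * \<kappa> * card (full us')"
      using pot pot1 ls'(5) by (simp add: z'_def algebra_simps)
    finally have "running us' lab' y'"
      unfolding running_def using base' lab' M' z' ls'
      by (intro conjI exI[of _ M'] exI[of _ z'] exI[of _ b'] exI[of _ ls']) (auto simp: us'_def)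
    then show "running (us @ [x]) lab' (y + 1 + card {v \<in> set us. lab' v \<noteq> lab v})"
      by (simp add: us'_def y'_def)
  qed
qed

lemma running_finished:
  assumes "running us lab y" "length us - N0 = Q"
  shows "finished us y"
proof -
  obtain M z b ls where base: "base us" and z: "z + card {v \<in> set us. M v \<noteq> lab v} \<le> y"
    and b: "b < B" "block_cnt us b < 2 * g"
    and ch: "chain_ok (border b) (border (Suc b)) (set us) M ls"
    and pot: "Q * (d / 2) \<le> potential (set us) ls + 16 * \<kappa> * z + 4 * g * \<kappa> * card (full us)"
    using assms unfolding running_def by auto
  have "potential (set us) ls \<le> 2 * \<kappa> * (real (block_cnt us b) - outer_cnt (border b) (border (Suc b)) (set us) ls)"
    using potential_le[OF ch] by (simp add: block_cnt_def)
  also have "\<dots> \<le> 2 * \<kappa> * (2 * g)"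
    using \<kappa>_pos b by (intro mult_left_mono) auto
  finally have p: "potential (set us) ls \<le> 4 * g * \<kappa>"
    by (simp add: algebra_simps)
  have "card (full us) \<le> card {..<B}"
    unfolding full_def by (intro card_mono) auto
  then have "4 * g * \<kappa> * card (full us) \<le> 4 * g * \<kappa> * B"
    using \<kappa>_pos by (intro mult_left_mono) auto
  moreover have "16 * \<kappa> * z \<le> 16 * \<kappa> * y"
    using z \<kappa>_pos by (intro mult_left_mono) auto
  ultimately show ?thesis
    using base pot p by (simp add: finished_def algebra_simps)
qed

text \<open>The remaining insertions only complete the blocks, as the predictions demand.\<close>

lemma finished_step:
  assumes "finished us y" "length us < n"
  shows "\<exists>u<N0 * 2 ^ n. u \<notin> set us \<and> (\<forall>y'\<ge>y. finished (us @ [u]) y')"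
proof -
  have base: "base us"
    using assms by (simp add: finished_def)
  obtain b where b: "b < B" "block_cnt us b < 2 * g"
    using base_unfilled[OF base assms(2)] by blast
  have bS: "border b \<in> set us"
    using base b by (simp add: base_def)
  note snoc = base_snoc[OF base assms(2) bS b(1) order_refl border_less[of b "Suc b"] b(2)]
  have "finished (us @ [border b + 2 ^ (n - Suc (length us))]) y'" if "y \<le> y'" for y'
  proof -
    have "16 * \<kappa> * y \<le> 16 * \<kappa> * y'"
      using that \<kappa>_pos by (intro mult_left_mono) auto
    then show ?thesis
      using assms snoc(5) by (simp add: finished_def)
  qed
  then show ?thesis
    using snoc(1,3) by (intro exI[of _ "border b + 2 ^ (n - Suc (length us))"]) simp
qed

text \<open>Three phases: the initial items in increasing order, \<open>Q\<close> insertions steered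
  by chains, and the completion of the blocks.\<close>

definition game :: "nat list \<Rightarrow> (nat \<Rightarrow> nat) \<Rightarrow> nat \<Rightarrow> bool" where
  "game us lab y \<longleftrightarrow>
     length us < N0 \<and> us = map (\<lambda>j. j * 2 ^ n) [0..<length us] \<or>
     length us - N0 \<le> Q \<and> running us lab y \<or> finished us y"

lemma game_Nil: "game [] lab 0"
  using N0_gt by (simp add: game_def)

lemma game_step:
  assumes "game us lab y" "length us < n"
  shows "\<exists>u<N0 * 2 ^ n. u \<notin> set us \<and> (\<forall>lab'. number_labeling m (set (us @ [u])) lab' \<longrightarrow>
    game (us @ [u]) lab' (y + 1 + card {v \<in> set us. lab' v \<noteq> lab v}))"
proof -
  consider (initial) "length us < N0" "us = map (\<lambda>j. j * 2 ^ n) [0..<length us]"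
    | (running) "length us - N0 < Q" "running us lab y" | (finished) "finished us y"
    using assms(1) running_finished unfolding game_def by (cases "length us - N0 = Q") auto
  then show ?thesis
  proof cases
    case initial
    define u where "u = length us * 2 ^ n"
    have snoc: "us @ [u] = map (\<lambda>j. j * 2 ^ n) [0..<Suc (length us)]"
      using initial(2) by (simp add: u_def)
    have "u < N0 * 2 ^ n"
      using initial(1) by (simp add: u_def)
    moreover have "distinct (us @ [u])"
      unfolding snoc by (auto simp: distinct_map inj_on_def)
    then have "u \<notin> set us"
      by simp
    moreover have "game (us @ [u]) lab' y'" if "number_labeling m (set (us @ [u])) lab'" for lab' y'
    proof (cases "Suc (length us) = N0")
      case True
      then have "us @ [u] = map (\<lambda>j. j * 2 ^ n) [0..<N0]"
        using snoc by simp
      then show ?thesis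
        using that running_initial[of lab' y'] by (simp add: game_def)
    next
      case False
      then show ?thesis
        using initial(1) snoc by (simp add: game_def)
    qed
    ultimately show ?thesis
      by blast
  next
    case running
    then obtain u where u: "u < N0 * 2 ^ n" "u \<notin> set us"
      "\<And>lab'. number_labeling m (set (us @ [u])) lab' \<Longrightarrow>
        running (us @ [u]) lab' (y + 1 + card {v \<in> set us. lab' v \<noteq> lab v})"
      using running_step[of us lab y] assms(2) by blast
    have "length (us @ [u]) - N0 \<le> Q"
      using running(1) by simp
    then show ?thesis
      using u unfolding game_def by blast
  next
    case finished
    then show ?thesis
      using finished_step[of us y] assms(2) unfolding game_def by fastforce
  qed
qed

lemma game_end:
  assumes "game us lab y" "length us = n"
  shows "finished us y"
proof -
  have "0 < g * B"
    using g_pos B_pos by simp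
  moreover have "n - N0 = g * B"
    using n_gt by (simp add: N0_def)
  ultimately have "\<not> n - N0 \<le> Q"
    using Q_le by linarith
  then show ?thesis
    using assms N0_le by (auto simp: game_def)
qed

end

section \<open>Existence of the adversaries and choice of parameters\<close>

theorem block_adversary_exists:
  fixes \<alpha> \<kappa> \<phi> :: real and kmin d n g B m Q :: nat
  assumes adv: "block_adversary \<alpha> \<kappa> \<phi> kmin d n g B m Q"
    and inf: "infinite (UNIV :: 'a::linorder set)"
  shows "\<exists>A :: 'a adversary. \<forall>D. list_labeling_structure n m D \<longrightarrow>
    distinct (map fst (inserted A D n)) \<and>
    (\<forall>q \<in> set (inserted A D n). prediction_error (inserted A D n) q \<le> 2 * g) \<and>
    Q * (d / 2) \<le> 16 * \<kappa> * total_movements D (inserted A D n) + 4 * g * \<kappa> * (B + 1)"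
proof -
  interpret block_adversary \<alpha> \<kappa> \<phi> kmin d n g B m Q
    by (rule adv)
  obtain e :: "nat \<Rightarrow> 'a" where e: "strict_mono_on {..<N0 * 2 ^ n} e"
    using infinite_linorder_chain[OF inf] by blast
  obtain A :: "'a adversary" where A: "\<And>D. list_labeling_structure n m D \<Longrightarrow>
    \<exists>us lab. length us = n \<and> distinct us \<and> set us \<subseteq> {..<N0 * 2 ^ n} \<and>
       inserted A D n = map (\<lambda>u. (e u, predicted u)) us \<and>
       game us lab (total_movements D (inserted A D n))"
    using adversary_from_invariant[where P = game and pred = predicted and n = n and m = m,
        OF e game_Nil game_step] by blast
  show ?thesis
  proof (intro exI[of _ A] allI impI)
    fix D :: "'a data_structure"
    assume "list_labeling_structure n m D"
    then obtain us lab where us: "length us = n" "distinct us" "set us \<subseteq> {..<N0 * 2 ^ n}"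
       and ins: "inserted A D n = map (\<lambda>u. (e u, predicted u)) us"
       and game: "game us lab (total_movements D (inserted A D n))"
      using A by blast
    have fin: "finished us (total_movements D (inserted A D n))"
      using game_end[OF game us(1)] .
    have "map fst (inserted A D n) = map e us"
      by (simp add: ins o_def)
    moreover have "distinct (map e us)"
      using us inj_on_subset[OF strict_mono_on_imp_inj_on[OF e]] by (simp add: distinct_map)
    moreover have "prediction_error (inserted A D n) q \<le> 2 * g" if q: "q \<in> set (inserted A D n)" for q
    proof -
      obtain u where u: "u \<in> set us" "q = (e u, predicted u)"
        using q ins by auto
      then show ?thesis
        using base_complete[of us u] fin us rank_embedded[OF e us(3) u(1), of predicted]
        by (simp add: prediction_error_def ins finished_def)
    qed
    ultimately show "distinct (map fst (inserted A D n)) \<and>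
      (\<forall>q \<in> set (inserted A D n). prediction_error (inserted A D n) q \<le> 2 * g) \<and>
      Q * (d / 2) \<le> 16 * \<kappa> * total_movements D (inserted A D n) + 4 * g * \<kappa> * (B + 1)"
      using fin by (simp add: finished_def)
  qed
qed

text \<open>This serves bounded \<eta>, where linear cost suffices: in increasing order all
  predictions are exact, and first labels already count as movements.\<close>

lemma increasing_adversary:
  assumes inf: "infinite (UNIV :: 'a::linorder set)"
  shows "\<exists>A :: 'a adversary. \<forall>D. list_labeling_structure n m D \<longrightarrow>
    distinct (map fst (inserted A D n)) \<and>
    (\<forall>q \<in> set (inserted A D n). prediction_error (inserted A D n) q = 0) \<and>
    n \<le> total_movements D (inserted A D n)"
proof -
  obtain e :: "nat \<Rightarrow> 'a" where e: "strict_mono_on {..<n} e"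
    using infinite_linorder_chain[OF inf] by blast
  define P where "P us (lab :: nat \<Rightarrow> nat) y \<longleftrightarrow> us = [0..<length us] \<and> length us \<le> y"
    for us lab and y :: nat
  have "\<exists>u<n. u \<notin> set us \<and> (\<forall>lab'. number_labeling m (set (us @ [u])) lab' \<longrightarrow>
    P (us @ [u]) lab' (y + 1 + card {v \<in> set us. lab' v \<noteq> lab v}))"
    if "P us lab y" "length us < n" for us lab y
  proof -
    have us: "us = [0..<length us]"
      using that by (simp add: P_def)
    have "length us \<notin> set us"
      by (subst us) simp
    moreover have "us @ [length us] = [0..<Suc (length us)]"
      using us by simp
    ultimately show ?thesis
      using that by (intro exI[of _ "length us"]) (auto simp: P_def)
  qed
  then obtain A :: "'a adversary" where A: "\<And>D. list_labeling_structure n m D \<Longrightarrow>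
    \<exists>us lab. length us = n \<and> distinct us \<and> set us \<subseteq> {..<n} \<and>
       inserted A D n = map (\<lambda>u. (e u, id u)) us \<and>
       P us lab (total_movements D (inserted A D n))"
    using adversary_from_invariant[where P = P and pred = id and n = n and m = m, OF e]
    unfolding P_def by auto
  show ?thesis
  proof (intro exI[of _ A] allI impI)
    fix D :: "'a data_structure"
    assume "list_labeling_structure n m D"
    then obtain us lab where us: "length us = n" "distinct us" "set us \<subseteq> {..<n}"
       and ins: "inserted A D n = map (\<lambda>u. (e u, id u)) us"
       and P: "P us lab (total_movements D (inserted A D n))"
      using A by blast
    have "map fst (inserted A D n) = map e us"
      by (simp add: ins o_def)
    moreover have "distinct (map e us)"
      using us inj_on_subset[OF strict_mono_on_imp_inj_on[OF e]] by (simp add: distinct_map)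
    moreover have "prediction_error (inserted A D n) q = 0" if q: "q \<in> set (inserted A D n)" for q
    proof -
      obtain u where u: "u \<in> set us" "q = (e u, id u)"
        using q ins by auto
      have "set us = {0..<n}"
        using P us(1) unfolding P_def by (metis set_upt)
      then have "{v \<in> set us. v < u} = {0..<u}"
        using u us by auto
      then show ?thesis
        using rank_embedded[OF e us(3) u(1), of id] u
        by (simp add: prediction_error_def ins)
    qed
    ultimately show "distinct (map fst (inserted A D n)) \<and>
      (\<forall>q \<in> set (inserted A D n). prediction_error (inserted A D n) q = 0) \<and>
      n \<le> total_movements D (inserted A D n)"
      using P us(1) by (simp add: P_def)
  qed
qed

text \<open>\<phi> is the score of \<open>g\<close> items in \<open>8 * c * g\<close> slots. Since
  \<open>\<alpha> * d = A\<close>, a chain loses \<open>6 * A\<close> in total, while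
  \<open>8 * d \<le> ln g\<close> makes the size bonus at least \<open>8 * A\<close>. The factor
  \<open>320\<close> turns \<open>\<kappa> * d / 2\<close> into \<open>20 * (8 * A)\<close>, which
  bounds the left side of \<open>growth\<close>; \<open>1280 * A \<le> d\<close> gives
  \<open>\<kappa> \<le> 1 / 4\<close>.\<close>

lemma block_adversary_parameters:
  fixes c :: real and n g :: nat
  defines "A \<equiv> ln (8 * c) + 1"
  defines "d \<equiv> nat \<lfloor>ln (real g) / 8\<rfloor>"
  defines "B \<equiv> (n - 1) div (2 * g)"
  assumes c: "1 < c" and g: "4 * g \<le> n" and large: "8 * (1280 * A + 1) \<le> ln (real g)"
  shows "block_adversary (A / d) (320 * A / d) (A / d * ln g - ln (8 * c)) d d n g B
    (nat \<lfloor>c * real n\<rfloor>) (g * B div 2)"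
    and "ln (real g) \<le> 16 * real d" "1280 * A \<le> real d" "0 < B" "0 < g" "1 \<le> A"
    "2 * g * B < n" "n \<le> 4 * (g * B)"
proof -
  have ln8c: "0 < ln (8 * c)"
    using c by simp
  then show A: "1 \<le> A"
    by (simp add: A_def)
  have lng: "10248 \<le> ln (real g)"
    using large A by simp
  have large': "10240 * A + 8 \<le> ln (real g)"
    using large by simp
  from lng show g0: "0 < g"
    by (cases "g = 0") auto
  have "ln (real g) \<le> real g - 1"
    using g0 by (intro ln_le_minus_one) auto
  then have g2: "2 \<le> g"
    using lng by linarith
  have "real d = of_int \<lfloor>ln (real g) / 8\<rfloor>"
    using lng by (simp add: d_def)
  then have d: "real d \<le> ln (real g) / 8" "ln (real g) / 8 - 1 < real d"
    by linarith+
  then show d1280: "1280 * A \<le> real d"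
    using large' by linarith
  then have d32: "32 \<le> d"
    using A by linarith
  show "ln (real g) \<le> 16 * real d"
    using d lng by linarith
  have "2 * g \<le> n - 1"
    using g g2 by simp
  then show B0: "0 < B"
    using g0 by (simp add: B_def div_greater_zero_iff)
  have "B * (2 * g) \<le> n - 1"
    unfolding B_def by (rule div_times_less_eq_dividend)
  then show nB: "2 * g * B < n"
    using g g2 by (simp add: algebra_simps)
  have "n - 1 < 2 * g + 2 * g * B"
    unfolding B_def using g0 by (intro dividend_less_times_div) simp
  then have nB': "n \<le> 2 * g * B + 2 * g"
    by simp
  moreover have "g \<le> g * B"
    using B0 by simp
  ultimately show n4: "n \<le> 4 * (g * B)"
    by linarith
  define \<alpha> where "\<alpha> = A / d"
  have \<alpha>: "0 < \<alpha>" "\<alpha> * d = A" "\<alpha> \<le> A"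
    using A d32 by (auto simp: \<alpha>_def field_simps mult_le_cancel_right1)
  have "real (nat \<lfloor>c * real n\<rfloor>) \<le> c * real n"
    using c by simp
  also have "\<dots> \<le> c * real (4 * (g * B))"
    using n4 c by (intro mult_left_mono of_nat_mono) auto
  finally have width: "2 * real (nat \<lfloor>c * real n\<rfloor>) / B \<le> 8 * c * g"
    using B0 by (simp add: field_simps)
  have n1: "1 \<le> real n"
    using nB by linarith
  have "1 * 1 \<le> c * real n"
    using c n1 by (intro mult_mono) auto
  then have m0: "0 < nat \<lfloor>c * real n\<rfloor>"
    by simp
  have "\<alpha> * ln g - ln (8 * c) \<le> log_score \<alpha> g (2 * real (nat \<lfloor>c * real n\<rfloor>) / B)"
  proof -
    have "ln (2 * real (nat \<lfloor>c * real n\<rfloor>) / B) \<le> ln (8 * c * g)"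
      using width m0 B0 by (intro ln_mono) auto
    also have "\<dots> = ln (8 * c) + ln g"
      using c g0 by (simp add: ln_mult)
    finally show ?thesis
      by (simp add: log_score_def algebra_simps)
  qed
  moreover have "\<alpha> * ln d \<le> (\<alpha> * ln g - ln (8 * c)) - 6 * \<alpha> * d"
  proof -
    have "ln (real d) \<le> real d - 1"
      using d32 by (intro ln_le_minus_one) auto
    then have "\<alpha> * ln d \<le> \<alpha> * d"
      using \<alpha> by (intro mult_left_mono) auto
    moreover have "\<alpha> * (8 * d) \<le> \<alpha> * ln g"
      using \<alpha> d by (intro mult_left_mono) auto
    ultimately show ?thesis
      using \<alpha>(2) by (simp add: A_def algebra_simps)
  qed
  moreover have "20 * (\<alpha> * ln (2 * real g) - (\<alpha> * ln g - ln (8 * c)) + 6 * \<alpha> * d) \<le> 320 * A / d * d / 2"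
  proof -
    have "\<alpha> * ln 2 \<le> \<alpha> * 1"
      using \<alpha> ln_2_less_1 by (intro mult_left_mono) auto
    then have "\<alpha> * ln 2 \<le> A"
      using \<alpha>(3) by linarith
    then have "\<alpha> * ln (2 * real g) - \<alpha> * ln g \<le> A"
      using g0 by (simp add: ln_mult algebra_simps)
    moreover have "320 * A / d * d = 320 * A"
      using d32 by simp
    ultimately show ?thesis
      using \<alpha>(2) by (simp add: A_def algebra_simps)
  qed
  moreover have "320 * A / d \<le> 1 / 4" "2 \<le> 320 * A / d * d" "0 < 320 * A / d"
    using d1280 d32 A by (auto simp: field_simps)
  ultimately show "block_adversary (A / d) (320 * A / d) (A / d * ln g - ln (8 * c)) d d n g B
    (nat \<lfloor>c * real n\<rfloor>) (g * B div 2)"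
    using \<alpha>(1) d32 g0 nB nB' g2 B0 m0 unfolding \<alpha>_def
    by unfold_locales auto
qed

theorem theorem2:
  fixes c :: real
  assumes "c > 1"
    and "infinite (UNIV :: 'a::linorder set)"
  shows "\<exists>C>0. \<forall>n \<eta>. \<eta> \<le> n \<longrightarrow>
    (\<exists>A :: 'a adversary. \<forall>D :: 'a data_structure.
       list_labeling_structure n (nat \<lfloor>c * real n\<rfloor>) D \<longrightarrow>
         distinct (map fst (inserted A D n)) \<and>
         (\<forall>q \<in> set (inserted A D n). prediction_error (inserted A D n) q \<le> \<eta>) \<and>
         real (total_movements D (inserted A D n)) \<ge> C * real n * (log 2 (real \<eta>))\<^sup>2)"
proof -
  define a where "a = ln (8 * c) + 1"
  \<comment> \<open>\<open>L\<close> is the threshold for \<open>ln (\<eta> div 4)\<close> from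
    which the block adversary applies, \<open>T\<close> bounds \<open>log 2 \<eta>\<close> below it,
    and \<open>E\<close> collects the constants of the main case.\<close>
  define L where "L = 8 * (1280 * a + 1)"
  define T where "T = 2 * (L + 6)"
  define E where "E = 1024 * 4096 * (320 * a)"
  have a: "1 \<le> a"
    using assms(1) by (simp add: a_def)
  then have pos: "8 \<le> L" "0 < T" "0 < E"
    by (auto simp: L_def T_def E_def)
  define C where "C = min (1 / T\<^sup>2) (1 / E)"
  \<comment> \<open>For \<open>\<eta> = 0\<close> both logarithms are \<open>0\<close> by
    convention.\<close>
  have log: "0 \<le> log 2 (real \<eta>)" "log 2 (real \<eta>) \<le> 2 * ln (real \<eta>)" for \<eta> :: nat
  proof -
    have "0 \<le> ln (real \<eta>)"
      by (cases "\<eta> = 0") auto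
    moreover have "ln (real \<eta>) * 1 \<le> ln (real \<eta>) * (2 * ln 2)"
      using ln_Suc_diff_ge[of 1] calculation by (intro mult_left_mono) auto
    ultimately show "0 \<le> log 2 (real \<eta>)" "log 2 (real \<eta>) \<le> 2 * ln (real \<eta>)"
      by (auto simp: log_def field_simps)
  qed
  have ln_div4: "ln (real \<eta>) \<le> 6 + ln (real (\<eta> div 4))" for \<eta> :: nat
  proof (cases "\<eta> div 4 = 0")
    case True
    then have "\<eta> \<le> 3"
      by simp
    have "ln (real \<eta>) \<le> 6"
    proof (cases "\<eta> = 0")
      case False
      then have "ln (real \<eta>) \<le> real \<eta> - 1"
        by (intro ln_le_minus_one) auto
      then show ?thesis
        using \<open>\<eta> \<le> 3\<close> by simp
    qed simp
    then show ?thesis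
      using True by simp
  next
    case False
    have "\<eta> < 4 + 4 * (\<eta> div 4)"
      by (rule dividend_less_times_div) simp
    then have "\<eta> \<le> 7 * (\<eta> div 4)"
      using False by linarith
    then have "real \<eta> \<le> real (7 * (\<eta> div 4))"
      by (rule of_nat_mono)
    then have "ln (real \<eta>) \<le> ln (7 * real (\<eta> div 4))"
      using False by (intro ln_mono) auto
    also have "\<dots> = ln 7 + ln (real (\<eta> div 4))"
      using False by (subst ln_mult) auto
    also have "ln (7::real) \<le> 6"
      using ln_le_minus_one[of "7::real"] by simp
    finally show ?thesis
      by simp
  qed
  show ?thesis
  proof (intro exI[of _ C] conjI allI impI)
    show "0 < C"
      using pos by (simp add: C_def)
    fix n \<eta> :: nat assume \<eta>n: "\<eta> \<le> n"
    define l where "l = log 2 (real \<eta>)"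
    have l: "0 \<le> l" "l \<le> 2 * ln (real \<eta>)"
      using log by (auto simp: l_def)
    \<comment> \<open>The error is at most \<open>2 * g\<close>; the further factor \<open>2\<close>
      leaves room for a block and a nonempty tail even if \<open>\<eta> = n\<close>.\<close>
    define g where "g = \<eta> div 4"
    have g: "4 * g \<le> \<eta>"
      by (simp add: g_def)
    show "\<exists>A :: 'a adversary. \<forall>D :: 'a data_structure.
       list_labeling_structure n (nat \<lfloor>c * real n\<rfloor>) D \<longrightarrow>
         distinct (map fst (inserted A D n)) \<and>
         (\<forall>q \<in> set (inserted A D n). prediction_error (inserted A D n) q \<le> \<eta>) \<and>
         real (total_movements D (inserted A D n)) \<ge> C * real n * (log 2 (real \<eta>))\<^sup>2"
    proof (cases "ln (real g) < L")
      case True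
      then have "l \<le> T"
        using l ln_div4[of \<eta>] by (simp add: g_def T_def)
      then have "l\<^sup>2 \<le> T\<^sup>2"
        using l by (intro power_mono) auto
      then have "C * l\<^sup>2 \<le> 1 / T\<^sup>2 * T\<^sup>2"
        using pos by (intro mult_mono) (auto simp: C_def)
      then have "C * l\<^sup>2 \<le> 1"
        using pos by simp
      then have "C * l\<^sup>2 * real n \<le> 1 * real n"
        by (intro mult_right_mono) auto
      then have small: "C * real n * l\<^sup>2 \<le> real n"
        by (simp add: algebra_simps)
      have "C * real n * l\<^sup>2 \<le> real y" if "n \<le> y" for y
        using small that by linarith
      then show ?thesis
        using increasing_adversary[OF assms(2), of n "nat \<lfloor>c * real n\<rfloor>"]
        unfolding l_def by fastforce
    next
      case False
      define d where "d = nat \<lfloor>ln (real g) / 8\<rfloor>"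
      define B where "B = (n - 1) div (2 * g)"
      have large: "8 * (1280 * (ln (8 * c) + 1) + 1) \<le> ln (real g)"
        using False by (simp add: L_def a_def)
      have "4 * g \<le> n"
        using g \<eta>n by simp
      note par = block_adversary_parameters[OF assms(1) this large, folded a_def d_def B_def]
      define \<kappa> where "\<kappa> = 320 * a / d"
      have d0: "0 < real d"
        using par(3) a by linarith
      have \<kappa>: "0 < \<kappa>" "\<kappa> * d = 320 * a"
        using d0 a by (auto simp: \<kappa>_def)
      have bound: "C * real n * l\<^sup>2 \<le> real y"
        if y: "real (g * B div 2) * (d / 2) \<le> 16 * \<kappa> * y + 4 * g * \<kappa> * (B + 1)" for y :: nat
      proof -
        have gB: "2 \<le> g * B"
        proof -
          have "ln (real g) \<le> real g - 1"
            using par by (intro ln_le_minus_one) auto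
          then have "2 \<le> g"
            using False pos by linarith
          then show ?thesis
            using par(4) by (metis Suc_leI mult_le_mono nat_mult_1_right One_nat_def)
        qed
        have "g * B \<le> 4 * (g * B div 2)"
          using gB by linarith
        then have "n \<le> 16 * (g * B div 2)"
          using par(8) by linarith
        then have Q: "real n \<le> 16 * real (g * B div 2)"
          by linarith
        have "g * (B + 1) \<le> n"
        proof -
          have "g \<le> g * B"
            using par(4) by simp
          moreover have "g * B + g * B < n"
            using par(7) by (simp add: algebra_simps)
          ultimately show ?thesis
            unfolding distrib_left by linarith
        qed
        then have gB1: "real g * (B + 1) \<le> real n"
          by (simp only: flip: of_nat_mult of_nat_le_iff)
        \<comment> \<open>Multiplication by \<open>2 * d\<close> turns \<kappa> into
          \<open>\<kappa> * d\<close>, which is the constant \<open>320 * a\<close>.\<close>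
        have "real n / 16 * (d * d) \<le> real (g * B div 2) * (d * d)"
          using Q by (intro mult_right_mono) auto
        also have "\<dots> \<le> 2 * d * (16 * \<kappa> * y + 4 * g * \<kappa> * (B + 1))"
          using mult_left_mono[OF y, of "2 * d"] by (simp add: algebra_simps)
        also have "\<dots> = \<kappa> * d * (32 * y + 8 * (g * (B + 1)))"
          by (simp add: algebra_simps)
        also have "\<dots> \<le> \<kappa> * d * (32 * y + 8 * real n)"
          by (rule mult_left_mono) (use \<kappa>(1) gB1 in \<open>simp_all add: distrib_left\<close>)
        finally have main: "real n * (d * d) \<le> 320 * a * (512 * y + 128 * real n)"
          unfolding \<kappa>(2) by (simp add: algebra_simps)
        \<comment> \<open>As \<open>1280 * a \<le> d\<close>, the term linear in \<open>n\<close> is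
          at most half of the left side and can be absorbed.\<close>
        have "(1280 * a) * (1280 * a) \<le> real d * d"
          using par(3) a by (intro mult_mono) auto
        moreover have "1 * a \<le> a * a"
          using a by (intro mult_right_mono) auto
        ultimately have "320 * a * 256 \<le> real d * d"
          using a by linarith
        then have "real n * (320 * a * 256) \<le> real n * (d * d)"
          by (intro mult_left_mono) auto
        then have main2: "real n * (d * d) \<le> 320 * a * 1024 * y"
          using main by (simp add: algebra_simps)
        have "ln (real \<eta>) \<le> 2 * ln (real g)"
          using ln_div4[of \<eta>] False pos by (simp add: g_def)
        then have "l \<le> 64 * real d"
          using l par(2) by linarith
        then have "l\<^sup>2 \<le> (64 * real d)\<^sup>2"
          using l by (intro power_mono) auto
        then have "l\<^sup>2 \<le> 4096 * (real d * d)"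
          by (simp add: power2_eq_square)
        then have "real n * l\<^sup>2 \<le> real n * (4096 * (real d * d))"
          by (intro mult_left_mono) auto
        also have "\<dots> \<le> E * y"
          using main2 by (simp add: E_def algebra_simps)
        finally have "1 / E * (real n * l\<^sup>2) \<le> y"
          using pos by (simp add: field_simps)
        moreover have "C * (real n * l\<^sup>2) \<le> 1 / E * (real n * l\<^sup>2)"
          by (intro mult_right_mono) (auto simp: C_def)
        ultimately show ?thesis
          by (simp add: mult.assoc)
      qed
      obtain A :: "'a adversary" where A: "\<And>D. list_labeling_structure n (nat \<lfloor>c * real n\<rfloor>) D \<Longrightarrow>
        distinct (map fst (inserted A D n)) \<and>
        (\<forall>q \<in> set (inserted A D n). prediction_error (inserted A D n) q \<le> 2 * g) \<and>
        real (g * B div 2) * (d / 2)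
          \<le> 16 * \<kappa> * total_movements D (inserted A D n) + 4 * g * \<kappa> * (B + 1)"
        using block_adversary_exists[OF par(1) assms(2)] unfolding \<kappa>_def by blast
      have "2 * g \<le> \<eta>"
        using g by simp
      then show ?thesis
        using A bound unfolding l_def by (intro exI[of _ A]) (meson le_trans)
    qed
  qed
qed

end
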